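(* Let $n\ge2$, $A_1,\dots,A_d\in\mathfrak{su}(n)$, and $\mathrm S_1\subseteq\{B_{ij}\}$, $\mathrm S_2\subseteq\{C_{ij}\}$, $\mathrm S_3\subseteq\{D_{ij}\}$ (all with $1\le i<j\le n$). Let $\mathscr G_{\rm drift}$ and $\mathscr G_{\rm contr}$ be the edge-colored multigraphs defined in the context, and suppose $\mathscr G_{\rm contr}$ is not connected. Then the system $\dot X=\mathsf B_0X+(\sum_{i=1}^m u_i\mathsf B_i)X$ is structurally controllable on $\mathrm{SU}(n)$ with respect to the pair of zero patterns $\big(\Sigma_{\rm r}(\{A_1,\dots,A_d\}),\Sigma_{\rm f}(\mathrm S_1\cup\mathrm S_2\cup\mathrm S_3)\big)$ if the following hold: (i) each connected component of $\mathscr G_{\rm contr}$ contains at least three nodes; (ii) $\mathscr G_{\rm drift}$ has no multi-edges and the union $\mathscr G_{\rm drift}\cup\mathscr G_{\rm contr}$ is connected; (iii) $\mathscr G_{\rm drift}\cup\mathscr G_{\rm contr}$ has a self-loop or a cycle containing an odd number of Red edges.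
   Context: $E_{ij}$ is the $n\times n$ matrix unit; $B_{ij}=E_{ij}-E_{ji}$, $C_{ij}=\mathrm i(E_{ij}+E_{ji})$, $D_{ij}=\mathrm i(E_{ii}-E_{jj})$. $\mathfrak{su}(n)$ (traceless skew-Hermitian matrices, a real Lie algebra) is the Lie algebra of $\mathrm{SU}(n)$. For a finite subset $\{g_s\}$ of a real Lie algebra, $\Sigma_{\rm f}(\{g_s\})=\{\sum l_sg_s:l_s\in\mathbb R\}$, $\Sigma_{\rm r}(\{g_s\})=\{\sum l_sg_s:l_s\in\mathbb R,l_s\ne0\ \forall s\}$. An edge-colored multigraph on $\mathrm V=\{1,\dots,n\}$ has edges $\{i,j;c\}$, $c\in\{\text{Blue},\text{Red},\text{Green}\}$; $\{i,i;c\}$ is a self-loop; a multi-edge is a collection of two or more edges (of different colors) with identical endpoints. $\mathscr G_{\rm drift}$ has: a Blue edge $\{i,j\}$ ($i\ne j$) iff $\mathrm{Re}([A_s]_{ij})=-\mathrm{Re}([A_s]_{ji})\ne0$ for some $s$; a Red edge $\{i,j\}$ ($i\ne j$) iff $\mathrm{Im}([A_s]_{ij})=\mathrm{Im}([A_s]_{ji})\ne0$ for some $s$; a Green self-loop $\{i,i\}$ iff $[A_s]_{ii}\ne0$ for some $s$. $\mathscr G_{\rm contr}$ has a Blue edge $\{i,j\}$ for each $B_{ij}\in\mathrm S_1$, a Red edge $\{i,j\}$ for each $C_{ij}\in\mathrm S_2$, and Green self-loops $\{i,i\},\{j,j\}$ for each $D_{ij}\in\mathrm S_3$. The union has node set $\mathrm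 V$ and the union of edge sets. A walk alternates nodes and edges with consecutive endpoints; a cycle is a closed walk; connected means any two nodes are joined by a walk; connected components are maximal connected subgraphs. For $\dot X=\mathsf B_0X+(\sum_{i=1}^m u_i\mathsf B_i)X$ on $\mathrm{SU}(n)$ (piecewise continuous real controls), controllable means every element of $\mathrm{SU}(n)$ is reachable from $X(0)=I$ at some time $T\ge0$; structurally controllable w.r.t. $(\Sigma_{\rm r}(\mathfrak g_\alpha),\Sigma_{\rm f}(\mathfrak g_\beta))$ means there exist $m\ge1$, $\mathsf B_0\in\Sigma_{\rm r}(\mathfrak g_\alpha)$, $\mathsf B_1,\dots,\mathsf B_m\in\Sigma_{\rm f}(\mathfrak g_\beta)$ making it controllable. *)

theory Defs
  imports "HOL-Analysis.Analysis"
begin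

type_synonym 'n cmat = "complex^'n^'n"

section \<open>Matrices\<close>

definition Emat :: "'n::finite \<Rightarrow> 'n \<Rightarrow> 'n cmat" where
  "Emat i j = (\<chi> k l. if k = i \<and> l = j then 1 else 0)"

definition Bmat :: "'n::finite \<Rightarrow> 'n \<Rightarrow> 'n cmat" where
  "Bmat i j = (\<chi> k l. Emat i j $ k $ l - Emat j i $ k $ l)"

definition Cmat :: "'n::finite \<Rightarrow> 'n \<Rightarrow> 'n cmat" where
  "Cmat i j = (\<chi> k l. \<i> * (Emat i j $ k $ l + Emat j i $ k $ l))"

definition Dmat :: "'n::finite \<Rightarrow> 'n \<Rightarrow> 'n cmat" where
  "Dmat i j = (\<chi> k l. \<i> * (Emat i i $ k $ l - Emat j j $ k $ l))"

definition adjoint_mat :: "'n::finite cmat \<Rightarrow> 'n cmat" where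
  "adjoint_mat A = (\<chi> k l. cnj (A $ l $ k))"

definition mtrace :: "'n::finite cmat \<Rightarrow> complex" where
  "mtrace A = (\<Sum>k\<in>UNIV. A $ k $ k)"

text \<open>su(n): traceless skew-Hermitian matrices\<close>
definition su :: "'n::finite cmat set" where
  "su = {A. adjoint_mat A = - A \<and> mtrace A = 0}"

text \<open>SU(n): unitary matrices of determinant 1\<close>
definition SU :: "'n::finite cmat set" where
  "SU = {X. adjoint_mat X ** X = mat 1 \<and> det X = 1}"

section \<open>Zero patterns\<close>

definition Sigma_f :: "'n::finite cmat set \<Rightarrow> 'n cmat set" where
  "Sigma_f G = {(\<Sum>g\<in>G. l g *\<^sub>R g) | l. True}"

definition Sigma_r :: "'n::finite cmat set \<Rightarrow> 'n cmat set" where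
  "Sigma_r G = {(\<Sum>g\<in>G. l g *\<^sub>R g) | l. \<forall>g\<in>G. l g \<noteq> 0}"

section \<open>Edge-colored multigraphs on the node set UNIV\<close>

datatype color = Blue | Red | Green

text \<open>An edge is its set of endpoints (a singleton for a self-loop) together with its colour.\<close>
type_synonym 'n edge = "'n set \<times> color"

definition drift_edges :: "'n::finite cmat set \<Rightarrow> 'n edge set" where
  "drift_edges As =
     {({i, j}, Blue) | i j. i \<noteq> j \<and> (\<exists>A\<in>As. Re (A $ i $ j) = - Re (A $ j $ i) \<and> Re (A $ i $ j) \<noteq> 0)}
   \<union> {({i, j}, Red) | i j. i \<noteq> j \<and> (\<exists>A\<in>As. Im (A $ i $ j) = Im (A $ j $ i) \<and> Im (A $ i $ j) \<noteq> 0)}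
   \<union> {({i}, Green) | i. \<exists>A\<in>As. A $ i $ i \<noteq> 0}"

definition contr_edges ::
  "'n::{finite,linorder} cmat set \<Rightarrow> 'n cmat set \<Rightarrow> 'n cmat set \<Rightarrow> 'n edge set" where
  "contr_edges S1 S2 S3 =
     {({i, j}, Blue) | i j. i < j \<and> Bmat i j \<in> S1}
   \<union> {({i, j}, Red) | i j. i < j \<and> Cmat i j \<in> S2}
   \<union> {({i}, Green) | i j. i < j \<and> Dmat i j \<in> S3}
   \<union> {({j}, Green) | i j. i < j \<and> Dmat i j \<in> S3}"

definition has_multi_edge :: "'n edge set \<Rightarrow> bool" where
  "has_multi_edge E \<longleftrightarrow> (\<exists>s c c'. c \<noteq> c' \<and> (s, c) \<in> E \<and> (s, c') \<in> E)"

definition has_self_loop :: "'n edge set \<Rightarrow> bool" where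
  "has_self_loop E \<longleftrightarrow> (\<exists>i c. ({i}, c) \<in> E)"

text \<open>A walk is a list of steps (u, e, v): edge e of E with endpoints u and v,
  consecutive steps sharing nodes.\<close>
definition is_walk :: "'n edge set \<Rightarrow> ('n \<times> 'n edge \<times> 'n) list \<Rightarrow> bool" where
  "is_walk E w \<longleftrightarrow>
     (\<forall>(u, e, v) \<in> set w. e \<in> E \<and> fst e = {u, v}) \<and>
     (\<forall>k. Suc k < length w \<longrightarrow> snd (snd (w ! k)) = fst (w ! Suc k))"

definition is_cycle :: "'n edge set \<Rightarrow> ('n \<times> 'n edge \<times> 'n) list \<Rightarrow> bool" where
  "is_cycle E w \<longleftrightarrow> is_walk E w \<and> w \<noteq> [] \<and> fst (hd w) = snd (snd (last w))"

definition num_red :: "('n \<times> 'n edge \<times> 'n) list \<Rightarrow> nat" where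
  "num_red w = length (filter (\<lambda>(u, e, v). snd e = Red) w)"

definition adj_rel :: "'n edge set \<Rightarrow> ('n \<times> 'n) set" where
  "adj_rel E = {(u, v). \<exists>c. ({u, v}, c) \<in> E}"

text \<open>Two nodes are joined by a walk iff they are related by the reflexive transitive closure.\<close>
definition graph_connected :: "'n edge set \<Rightarrow> bool" where
  "graph_connected E \<longleftrightarrow> (\<forall>u v. (u, v) \<in> (adj_rel E)\<^sup>*)"

text \<open>Node sets of the connected components.\<close>
definition components :: "'n edge set \<Rightarrow> 'n set set" where
  "components E = {{v. (u, v) \<in> (adj_rel E)\<^sup>*} | u. True}"

section \<open>Control system on SU(n)\<close>

definition piecewise_continuous_on :: "real \<Rightarrow> real \<Rightarrow> (real \<Rightarrow> real) \<Rightarrow> bool" where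
  "piecewise_continuous_on a b u \<longleftrightarrow>
     (\<exists>D. finite D \<and> D \<subseteq> {a..b} \<and> continuous_on ({a..b} - D) u \<and>
        (\<forall>d\<in>D. (d > a \<longrightarrow> (\<exists>l. (u \<longlongrightarrow> l) (at_left d))) \<and>
                (d < b \<longrightarrow> (\<exists>l. (u \<longlongrightarrow> l) (at_right d)))))"

text \<open>X solves dX/dt = B0 X + (sum_i u_i B_i) X on [0,T] with X(0) = I
  (continuous, satisfying the ODE except at finitely many times).\<close>
definition is_solution ::
  "'n::finite cmat \<Rightarrow> 'n cmat list \<Rightarrow> (nat \<Rightarrow> real \<Rightarrow> real) \<Rightarrow> real \<Rightarrow> (real \<Rightarrow> 'n cmat) \<Rightarrow> bool" where
  "is_solution B0 Bs u T X \<longleftrightarrow>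
     X 0 = mat 1 \<and> continuous_on {0..T} X \<and>
     (\<exists>S. finite S \<and> (\<forall>t\<in>{0..T} - S.
        (X has_vector_derivative
           ((B0 + (\<Sum>i<length Bs. u i t *\<^sub>R Bs ! i)) ** X t)) (at t within {0..T})))"

definition reachable_at :: "'n::finite cmat \<Rightarrow> 'n cmat list \<Rightarrow> real \<Rightarrow> 'n cmat \<Rightarrow> bool" where
  "reachable_at B0 Bs T Y \<longleftrightarrow>
     (\<exists>u X. (\<forall>i<length Bs. piecewise_continuous_on 0 T (u i)) \<and>
            is_solution B0 Bs u T X \<and> X T = Y)"

text \<open>Controls u_1..u_m are u 0 .. u (m-1); B_1..B_m are Bs!0 .. Bs!(m-1).\<close>
definition controllable :: "'n::finite cmat \<Rightarrow> 'n cmat list \<Rightarrow> bool" where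
  "controllable B0 Bs \<longleftrightarrow> (\<forall>Y\<in>SU. \<exists>T\<ge>0. reachable_at B0 Bs T Y)"

definition structurally_controllable :: "'n::finite cmat set \<Rightarrow> 'n cmat set \<Rightarrow> bool" where
  "structurally_controllable Ga Gb \<longleftrightarrow>
     (\<exists>B0 Bs. length Bs \<ge> 1 \<and> B0 \<in> Sigma_r Ga \<and> set Bs \<subseteq> Sigma_f Gb \<and> controllable B0 Bs)"

end

theory Submission
  imports Defs
begin

text \<open>
  Every exponential \<open>exp (t Z)\<close> with \<open>t \<ge> 0\<close> and \<open>Z = B0 + \<Sum> c_i B_i\<close> is reachable, so the reachable
  set contains the semigroup \<open>S\<close> generated by these exponentials. Its closure is a compact
  subsemigroup of \<open>SU(n)\<close>, hence a group, and the matrices \<open>Z\<close> with \<open>exp (t Z)\<close> in the closure for all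
  real \<open>t\<close> form a Lie algebra containing \<open>B0\<close> and the \<open>B_i\<close>. If these generate \<open>su(n)\<close>, then \<open>S\<close> is
  dense: an element of \<open>SU(n)\<close> is moved to the identity one column at a time, by maximizing the real
  part of a diagonal entry over the closure. Moreover the conjugates \<open>s Z s*\<close> with \<open>s\<close> in \<open>S\<close> then
  span \<open>su(n)\<close>, so a product of exponentials with variable durations has a surjective differential
  and \<open>S\<close> has interior points in \<open>SU(n)\<close>. A dense subsemigroup with interior points is everything.

  For the generation, a drift with generic coefficients has a nonzero entry at every drift edge.
  Three nodes per control component allow iterated brackets with control elements to isolate the
  entries of the drift between different components; as the drift has no multi-edges, each isolated
  entry yields \<open>B_ij\<close> or \<open>C_ij\<close>, and by connectedness one of the two lies in the Lie algebra for each
  pair \<open>i, j\<close>. If never both do, then the colours form a cocycle, so every cycle has an even number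
  of red edges and all diagonal entries vanish. Otherwise the Lie algebra is \<open>su(n)\<close>.
\<close>

section \<open>Matrix multiplication, adjoint and trace\<close>

lemma bounded_bilinear_matrix_mult:
  "bounded_bilinear ((**) :: 'a::{real_algebra_1,euclidean_space}^'k^'m \<Rightarrow> 'a^'n^'k \<Rightarrow> 'a^'n^'m)"
  unfolding bilinear_conv_bounded_bilinear[symmetric] bilinear_def
  by (auto intro!: linearI simp: vec_eq_iff matrix_matrix_mult_def algebra_simps
      sum.distrib scaleR_sum_right)

interpretation matmul: bounded_bilinear "(**) :: 'n::finite cmat \<Rightarrow> 'n cmat \<Rightarrow> 'n cmat"
  by (rule bounded_bilinear_matrix_mult)

lemma diagonal_mult_entry:
  fixes D :: "'a::semiring_1^'m^'m" and X :: "'a^'n^'m"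
  assumes "\<And>i j. i \<noteq> j \<Longrightarrow> D $ i $ j = 0"
  shows "(D ** X) $ k $ l = D $ k $ k * X $ k $ l"
proof -
  have "(D ** X) $ k $ l = (\<Sum>m\<in>UNIV. if m = k then D $ k $ k * X $ k $ l else 0)"
    unfolding matrix_matrix_mult_def vec_lambda_beta by (rule sum.cong) (auto simp: assms)
  then show ?thesis by simp
qed

lemma mult_diagonal_entry:
  fixes D :: "'a::semiring_1^'m^'m" and X :: "'a^'m^'n"
  assumes "\<And>i j. i \<noteq> j \<Longrightarrow> D $ i $ j = 0"
  shows "(X ** D) $ k $ l = X $ k $ l * D $ l $ l"
proof -
  have "(X ** D) $ k $ l = (\<Sum>m\<in>UNIV. if m = l then X $ k $ l * D $ l $ l else 0)"
    unfolding matrix_matrix_mult_def vec_lambda_beta by (rule sum.cong) (auto simp: assms)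
  then show ?thesis by simp
qed

lemma mat_mult_mat: "mat a ** mat b = (mat (a * b) :: 'a::semiring_1^'n^'n)"
proof -
  have "(mat a ** mat b :: 'a^'n^'n) $ k $ l = mat (a * b) $ k $ l" for k l
    by (subst diagonal_mult_entry) (simp_all add: mat_def)
  then show ?thesis by (simp add: vec_eq_iff)
qed

lemma adjoint_mat_entry [simp]: "adjoint_mat A $ i $ j = cnj (A $ j $ i)"
  by (simp add: adjoint_mat_def)

lemma linear_adjoint_mat: "linear adjoint_mat"
  by (rule linearI) (simp_all add: vec_eq_iff)

lemmas adjoint_mat_add = linear_add[OF linear_adjoint_mat]
  and adjoint_mat_diff = linear_diff[OF linear_adjoint_mat]
  and adjoint_mat_scaleR = linear_scale[OF linear_adjoint_mat]
  and bounded_linear_adjoint_mat = linear_adjoint_mat[unfolded linear_conv_bounded_linear]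

lemma adjoint_mat_mult: "adjoint_mat (A ** B) = adjoint_mat B ** adjoint_mat A"
  by (simp add: matrix_matrix_mult_def vec_eq_iff mult.commute)

lemma adjoint_mat_adjoint_mat [simp]: "adjoint_mat (adjoint_mat A) = A"
  by (simp add: vec_eq_iff)

lemma adjoint_mat_mat [simp]: "adjoint_mat (mat z) = mat (cnj z)"
  by (simp add: mat_def vec_eq_iff)

lemma det_adjoint_mat: "det (adjoint_mat A) = cnj (det A)"
proof -
  have "adjoint_mat A = transpose (\<chi> i j. cnj (A $ i $ j))"
    by (simp add: adjoint_mat_def transpose_def)
  then show ?thesis
    by (simp add: det_transpose) (simp add: det_def)
qed

lemma linear_trace: "linear (trace :: 'a::{real_algebra_1,comm_semiring_1}^'n^'n \<Rightarrow> 'a)"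
  by (rule linearI) (simp_all add: trace_def sum.distrib scaleR_sum_right)

lemmas trace_scaleR = linear_scale[OF linear_trace]

lemma trace_mat: "trace (mat z :: 'a::comm_semiring_1^'n^'n) = of_nat CARD('n) * z"
  by (simp add: trace_def mat_def)

lemma det_mat: "det (mat z :: 'a::comm_ring_1^'n^'n) = z ^ CARD('n)"
  by (simp add: det_diagonal mat_def)

lemma mtrace_eq_trace: "mtrace A = trace A"
  by (simp add: mtrace_def trace_def)

lemma trace_adjoint_mat: "trace (adjoint_mat A) = cnj (trace A)"
  by (simp add: trace_def)

lemma inner_cmat: "A \<bullet> B = Re (trace (adjoint_mat A ** B))" for A B :: "'n::finite cmat"
proof -
  have "A \<bullet> B = (\<Sum>i\<in>UNIV. \<Sum>j\<in>UNIV. Re (cnj (A $ i $ j) * B $ i $ j))"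
    by (simp add: inner_vec_def inner_complex_def)
  also have "\<dots> = (\<Sum>j\<in>UNIV. \<Sum>i\<in>UNIV. Re (cnj (A $ i $ j) * B $ i $ j))"
    by (rule sum.swap)
  finally show ?thesis
    by (simp add: trace_def matrix_matrix_mult_def)
qed

lemma norm_adjoint_mat [simp]: "norm (adjoint_mat A) = norm A"
  unfolding norm_eq_sqrt_inner inner_cmat adjoint_mat_adjoint_mat
  by (subst trace_mul_sym) (rule refl)

lemma norm_isometry_mult:
  fixes U A :: "'n::finite cmat"
  assumes "adjoint_mat U ** U = mat 1"
  shows "norm (U ** A) = norm A"
proof -
  have "adjoint_mat (U ** A) ** (U ** A) = adjoint_mat A ** (adjoint_mat U ** U) ** A"
    by (simp add: adjoint_mat_mult matrix_mul_assoc)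
  then show ?thesis
    using assms by (simp add: norm_eq_sqrt_inner inner_cmat)
qed

lemma continuous_on_det: "continuous_on S (det :: 'a::real_normed_field^'n^'n \<Rightarrow> 'a)"
  unfolding det_def by (intro continuous_intros)

lemma permutes_moves_another:
  assumes "p permutes S" "p \<noteq> id"
  obtains j where "j \<noteq> i" "p j \<noteq> j"
proof -
  obtain k where "p k \<noteq> k" using assms(2) by (metis eq_id_iff)
  moreover from this have "p (p k) \<noteq> p k" using permutes_inj[OF assms(1)] by (simp add: inj_eq)
  ultimately show thesis using that[of k] that[of "p k"] by metis
qed

lemma has_derivative_det_one:
  "((det :: 'a::real_normed_field^'n^'n \<Rightarrow> 'a) has_derivative trace) (at (mat 1))"
proof -
  let ?P = "{p. p permutes (UNIV :: 'n set)}"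
  let ?I = "mat 1 :: 'a^'n^'n"
  let ?D = "\<lambda>p (H :: 'a^'n^'n). \<Sum>i\<in>UNIV. H $ i $ p i * (\<Prod>j\<in>UNIV - {i}. ?I $ j $ p j)"
  have "((\<lambda>A :: 'a^'n^'n. \<Sum>p\<in>?P. of_int (sign p) * (\<Prod>i\<in>UNIV. A $ i $ p i)) has_derivative
      (\<lambda>H. \<Sum>p\<in>?P. of_int (sign p) * ?D p H)) (at ?I)"
    by (intro has_derivative_sum has_derivative_mult_right has_derivative_prod
        bounded_linear_imp_has_derivative bounded_linear_compose[OF bounded_linear_vec_nth]
        bounded_linear_vec_nth)
  moreover have "(\<Sum>p\<in>?P. of_int (sign p) * ?D p H) = trace H" for H
  proof -
    have "?D p H = 0" if p: "p permutes UNIV" "p \<noteq> id" for p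
    proof (rule sum.neutral, rule ballI)
      fix i :: 'n
      obtain j where "j \<noteq> i" "p j \<noteq> j" using permutes_moves_another[OF p] .
      then have "(\<Prod>j\<in>UNIV - {i}. ?I $ j $ p j) = 0"
        by (intro prod_zero bexI[of _ j]) (auto simp: mat_def)
      then show "H $ i $ p i * (\<Prod>j\<in>UNIV - {i}. ?I $ j $ p j) = 0" by simp
    qed
    then have "(\<Sum>p\<in>?P. of_int (sign p) * ?D p H) = (\<Sum>p\<in>{id}. of_int (sign p) * ?D p H)"
      by (intro sum.mono_neutral_right) (auto simp: permutes_id finite_permutations)
    also have "\<dots> = trace H"
      by (simp add: trace_def mat_def sign_id)
    finally show ?thesis .
  qed
  ultimately show ?thesis
    by (simp add: det_def[abs_def])
qed

section \<open>The matrix exponential\<close>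

text \<open>The library multiplies elements of type \<^typ>\<open>'n cmat\<close> entrywise; a copy of the type
  that carries the matrix product and the operator norm of left multiplication is a Banach
  algebra, so that the generic exponential applies.\<close>

typedef 'n matalg = "UNIV :: 'n::finite cmat set"
  morphisms mat_of alg_of ..

setup_lifting type_definition_matalg

instantiation matalg :: (finite) real_normed_algebra_1
begin

lift_definition zero_matalg :: "'a matalg" is 0 .
lift_definition one_matalg :: "'a matalg" is "mat 1" .
lift_definition plus_matalg :: "'a matalg \<Rightarrow> 'a matalg \<Rightarrow> 'a matalg" is "(+)" .
lift_definition minus_matalg :: "'a matalg \<Rightarrow> 'a matalg \<Rightarrow> 'a matalg" is "(-)" .
lift_definition uminus_matalg :: "'a matalg \<Rightarrow> 'a matalg" is uminus .
lift_definition times_matalg :: "'a matalg \<Rightarrow> 'a matalg \<Rightarrow> 'a matalg" is "(**)" .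
lift_definition scaleR_matalg :: "real \<Rightarrow> 'a matalg \<Rightarrow> 'a matalg" is "(*\<^sub>R)" .
lift_definition norm_matalg :: "'a matalg \<Rightarrow> real" is "\<lambda>A. onorm (\<lambda>B::'a cmat. A ** B)" .
definition dist_matalg :: "'a matalg \<Rightarrow> 'a matalg \<Rightarrow> real" where
  "dist_matalg a b = norm (a - b)"
definition uniformity_matalg :: "('a matalg \<times> 'a matalg) filter" where
  "uniformity_matalg = (INF e\<in>{0 <..}. principal {(x, y). dist x y < e})"
definition open_matalg :: "'a matalg set \<Rightarrow> bool" where
  "open_matalg S = (\<forall>x\<in>S. \<forall>\<^sub>F (x', y) in uniformity. x' = x \<longrightarrow> y \<in> S)"
definition sgn_matalg :: "'a matalg \<Rightarrow> 'a matalg" where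
  "sgn_matalg x = scaleR (inverse (norm x)) x"

instance
proof
  fix a b c :: "'a matalg" and r s :: real and U :: "'a matalg set"
  note bounded = matmul.bounded_linear_right
  show "norm (a * b) \<le> norm a * norm b"
    by transfer (use onorm_compose[OF bounded bounded] in \<open>simp add: o_def matrix_mul_assoc\<close>)
  show "norm (1 :: 'a matalg) = 1"
    by transfer (simp add: onorm_id)
  show "norm (a + b) \<le> norm a + norm b"
    by transfer (unfold matmul.add_left, rule onorm_triangle[OF bounded bounded])
  show "norm (r *\<^sub>R a) = \<bar>r\<bar> * norm a"
    by transfer (unfold matmul.scaleR_left, rule onorm_scaleR[OF bounded])
  show "(norm a = 0) = (a = 0)"
  proof transfer
    fix A :: "'a cmat"
    have "A ** mat 1 = A" by simp
    then show "(onorm (\<lambda>B::'a cmat. A ** B) = 0) = (A = 0)"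
      unfolding onorm_eq_0[OF bounded] by (metis matmul.zero_left)
  qed
  show "(0::'a matalg) \<noteq> 1"
    by transfer (auto simp: vec_eq_iff mat_def)
qed (unfold dist_matalg_def open_matalg_def sgn_matalg_def uniformity_matalg_def,
    (rule refl | (transfer, simp add: matrix_mul_assoc matmul.add_left matmul.add_right
      matmul.scaleR_left matmul.scaleR_right scaleR_add_left scaleR_add_right)
     )+)

end

lemma bounded_linear_mat_of: "bounded_linear (mat_of :: 'n::finite matalg \<Rightarrow> 'n cmat)"
proof (rule bounded_linear_intro)
  fix a b :: "'n matalg" and r :: real
  show "mat_of (a + b) = mat_of a + mat_of b" by transfer simp
  show "mat_of (r *\<^sub>R a) = r *\<^sub>R mat_of a" by transfer simp
  show "norm (mat_of a) \<le> norm a * norm (mat 1 :: 'n cmat)"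
    by transfer (metis onorm[OF matmul.bounded_linear_right] matrix_mul_rid)
qed

lemma bounded_linear_alg_of: "bounded_linear (alg_of :: 'n::finite cmat \<Rightarrow> 'n matalg)"
proof -
  obtain K where K: "K > 0" "\<And>(A::'n cmat) (B::'n cmat). norm (A ** B) \<le> norm A * norm B * K"
    using matmul.pos_bounded by blast
  show ?thesis
  proof (rule bounded_linear_intro)
    fix a b :: "'n cmat" and r :: real
    show "alg_of (a + b) = alg_of a + alg_of b" by (simp add: plus_matalg.abs_eq)
    show "alg_of (r *\<^sub>R a) = r *\<^sub>R alg_of a" by (simp add: scaleR_matalg.abs_eq)
    show "norm (alg_of a) \<le> norm a * K"
      unfolding norm_matalg.abs_eq by (rule onorm_le) (metis K(2) mult.assoc mult.commute)
  qed
qed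

instance matalg :: (finite) banach
proof
  fix X :: "nat \<Rightarrow> 'a matalg"
  assume "Cauchy X"
  then have "Cauchy (\<lambda>n. mat_of (X n))"
    by (rule bounded_linear.Cauchy[OF bounded_linear_mat_of])
  then obtain L where "(\<lambda>n. mat_of (X n)) \<longlonglongrightarrow> L"
    using Cauchy_convergent_iff convergent_def by blast
  then have "(\<lambda>n. alg_of (mat_of (X n))) \<longlonglongrightarrow> alg_of L"
    by (rule bounded_linear.tendsto[OF bounded_linear_alg_of])
  then show "convergent X"
    by (auto simp: mat_of_inverse convergent_def)
qed

definition mexp :: "'n::finite cmat \<Rightarrow> 'n cmat" where
  "mexp A = mat_of (exp (alg_of A))"

lemma mexp_zero [simp]: "mexp 0 = mat 1"
  using one_matalg.rep_eq by (simp add: mexp_def flip: zero_matalg_def)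

lemma mexp_add_commuting:
  assumes "A ** B = B ** A"
  shows "mexp (A + B) = mexp A ** mexp B"
proof -
  have "alg_of A * alg_of B = alg_of B * alg_of A"
    using assms by (simp add: times_matalg.abs_eq)
  then show ?thesis
    by (simp add: mexp_def exp_add_commuting times_matalg.rep_eq flip: plus_matalg.abs_eq)
qed

lemma mexp_minus_inverse: "mexp A ** mexp (- A) = mat 1"
  using mexp_add_commuting[of A "- A"] by (simp add: matmul.minus_left matmul.minus_right)

lemma mexp_has_vector_derivative:
  "((\<lambda>t. mexp (t *\<^sub>R A)) has_vector_derivative A ** mexp (t *\<^sub>R A)) (at t within S)"
proof -
  have "((\<lambda>t. mat_of (exp (t *\<^sub>R alg_of A))) has_vector_derivative
      mat_of (alg_of A * exp (t *\<^sub>R alg_of A))) (at t)"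
    by (intro bounded_linear.has_vector_derivative[OF bounded_linear_mat_of]
        exp_scaleR_has_vector_derivative_left)
  then show ?thesis
    by (simp add: mexp_def scaleR_matalg.abs_eq times_matalg.rep_eq alg_of_inverse
        has_vector_derivative_at_within)
qed

lemma mexp_scaleR_commute: "mexp (t *\<^sub>R A) ** A = A ** mexp (t *\<^sub>R A)"
proof -
  have "mat_of (exp (t *\<^sub>R alg_of A) * alg_of A) = mat_of (alg_of A * exp (t *\<^sub>R alg_of A))"
    by (simp add: exp_times_scaleR_commute)
  then show ?thesis
    by (simp add: mexp_def scaleR_matalg.abs_eq times_matalg.rep_eq alg_of_inverse)
qed

lemma continuous_on_mexp: "continuous_on S (\<lambda>t. mexp (t *\<^sub>R A))"
  by (rule continuous_on_vector_derivative) (rule mexp_has_vector_derivative)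

lemma mexp_ode_unique:
  fixes R :: "real \<Rightarrow> 'n::finite cmat"
  assumes "\<And>t. (R has_vector_derivative A ** R t) (at t)"
  shows "R t = mexp (t *\<^sub>R A) ** R 0"
proof -
  have "((\<lambda>t. mexp (t *\<^sub>R (- A)) ** R t) has_vector_derivative 0) (at t)" for t
  proof -
    have "((\<lambda>t. mexp (t *\<^sub>R (- A)) ** R t) has_vector_derivative
        mexp (t *\<^sub>R (- A)) ** (A ** R t) + (- A) ** mexp (t *\<^sub>R (- A)) ** R t) (at t)"
      by (intro matmul.has_vector_derivative mexp_has_vector_derivative assms)
    then show ?thesis
      unfolding mexp_scaleR_commute[symmetric]
      by (simp add: matrix_mul_assoc matmul.minus_right matmul.minus_left)
  qed
  then obtain C where constant_C: "\<And>t. mexp (t *\<^sub>R (- A)) ** R t = C"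
    using has_vector_derivative_zero_constant[OF convex_UNIV, of "\<lambda>t. mexp (t *\<^sub>R (- A)) ** R t"]
    by auto
  have "mexp (t *\<^sub>R A) ** (mexp (- (t *\<^sub>R A)) ** R t) = mexp (t *\<^sub>R A) ** R 0"
    using constant_C[of t] constant_C[of 0] by simp
  then show ?thesis
    by (simp add: matrix_mul_assoc mexp_minus_inverse)
qed

lemma mexp_intertwine:
  fixes U :: "'n::finite cmat"
  assumes "U ** A = B ** U"
  shows "U ** mexp (t *\<^sub>R A) = mexp (t *\<^sub>R B) ** U"
proof -
  have "((\<lambda>t. U ** mexp (t *\<^sub>R A)) has_vector_derivative U ** (A ** mexp (t *\<^sub>R A))) (at t)" for t
    by (intro bounded_linear.has_vector_derivative[OF matmul.bounded_linear_right]
        mexp_has_vector_derivative)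
  then show ?thesis
    using mexp_ode_unique[of "\<lambda>t. U ** mexp (t *\<^sub>R A)" B t] by (simp add: matrix_mul_assoc assms)
qed

lemma mexp_conj:
  fixes U V :: "'n::finite cmat"
  assumes "V ** U = mat 1"
  shows "U ** mexp (t *\<^sub>R A) ** V = mexp (t *\<^sub>R (U ** A ** V))"
proof -
  have "U ** A = U ** A ** V ** U" using assms by (simp flip: matrix_mul_assoc)
  moreover have "U ** V = mat 1" using assms by (metis matrix_left_right_inverse)
  ultimately show ?thesis using mexp_intertwine by (metis matrix_mul_assoc matrix_mul_rid)
qed

lemma mexp_mult_if_annihilates:
  fixes X :: "'n::finite cmat"
  assumes "A ** X = 0"
  shows "mexp (t *\<^sub>R A) ** X = X"
  using mexp_ode_unique[of "\<lambda>_. X" A t] by (simp add: assms)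

lemma adjoint_mexp: "adjoint_mat (mexp A) = mexp (adjoint_mat A)"
proof -
  have "((\<lambda>t. adjoint_mat (mexp (t *\<^sub>R A))) has_vector_derivative
      adjoint_mat A ** adjoint_mat (mexp (t *\<^sub>R A))) (at t)" for t
    using bounded_linear.has_vector_derivative[OF bounded_linear_adjoint_mat
        mexp_has_vector_derivative[of A t UNIV]]
    by (simp add: adjoint_mat_mult flip: mexp_scaleR_commute)
  from mexp_ode_unique[OF this, of 1] show ?thesis by simp
qed

lemma det_mexp: "det (mexp A) = exp (trace A)" for A :: "'n::finite cmat"
proof -
  define \<phi> where "\<phi> t = exp (t *\<^sub>R (- trace A)) * det (mexp (t *\<^sub>R A))" for t
  have "((\<lambda>t. det (mexp (t *\<^sub>R A))) has_vector_derivative trace A * det (mexp (t *\<^sub>R A))) (at t)" for t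
  proof -
    let ?E = "mexp (t *\<^sub>R A)" and ?E' = "mexp (- (t *\<^sub>R A))"
    have inverse: "?E ** ?E' = mat 1" "?E' ** ?E = mat 1"
      using mexp_minus_inverse[of "t *\<^sub>R A"] by (simp_all add: matrix_left_right_inverse)
    have "((\<lambda>s. mexp (s *\<^sub>R A) ** ?E') has_vector_derivative A) (at t)"
      using bounded_linear.has_vector_derivative[OF matmul.bounded_linear_left
          mexp_has_vector_derivative[of A t UNIV], of ?E']
      by (simp add: inverse flip: matrix_mul_assoc)
    from has_derivative_compose[OF this[unfolded has_vector_derivative_def], of det trace]
    have "((\<lambda>s. det (mexp (s *\<^sub>R A) ** ?E')) has_vector_derivative trace A) (at t)"
      by (simp add: has_vector_derivative_def inverse has_derivative_det_one trace_scaleR)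
    from has_vector_derivative_mult_left[OF this, of "det ?E"]
    show ?thesis
      by (simp add: inverse flip: det_mul matrix_mul_assoc)
  qed
  from has_vector_derivative_mult[OF exp_scaleR_has_vector_derivative_left[of "- trace A"] this]
  have "(\<phi> has_vector_derivative 0) (at t)" for t
    unfolding \<phi>_def by (simp only: mult_minus_left mult.assoc mult.left_commute[of "trace A"]) simp
  then have "\<phi> 1 = \<phi> 0"
    using has_vector_derivative_zero_constant[OF convex_UNIV, of \<phi>] by (metis UNIV_I)
  then show ?thesis
    by (simp add: \<phi>_def exp_minus field_simps)
qed

section \<open>The special unitary group and its Lie algebra\<close>

abbreviation skew_hermitian :: "'n::finite cmat \<Rightarrow> bool" where
  "skew_hermitian A \<equiv> adjoint_mat A = - A"

lemma in_su_iff: "A \<in> su \<longleftrightarrow> skew_hermitian A \<and> trace A = 0"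
  by (simp add: su_def mtrace_eq_trace)

lemma skew_hermitian_entry:
  assumes "skew_hermitian A" shows "A $ j $ i = - cnj (A $ i $ j)"
proof -
  have "adjoint_mat A $ j $ i = (- A) $ j $ i" using assms by simp
  then show ?thesis by simp
qed

lemma Re_skew_hermitian_diag: "skew_hermitian A \<Longrightarrow> Re (A $ i $ i) = 0"
  using arg_cong[OF skew_hermitian_entry[of A i i], of Re] by simp

lemma subspace_su: "subspace su"
  unfolding subspace_def
  by (auto simp: in_su_iff adjoint_mat_add adjoint_mat_scaleR trace_add trace_scaleR
      linear_0[OF linear_adjoint_mat] linear_0[OF linear_trace])

lemma SU_adjoint_left: "X \<in> SU \<Longrightarrow> adjoint_mat X ** X = mat 1"
  by (simp add: SU_def)

lemma SU_adjoint_right: "X \<in> SU \<Longrightarrow> X ** adjoint_mat X = mat 1"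
  by (metis SU_adjoint_left matrix_left_right_inverse)

lemma SU_one [simp]: "mat 1 \<in> SU"
  by (simp add: SU_def)

lemma SU_mult: "X \<in> SU \<Longrightarrow> Y \<in> SU \<Longrightarrow> X ** Y \<in> SU"
  unfolding SU_def mem_Collect_eq adjoint_mat_mult det_mul
  by (metis (no_types) matrix_mul_assoc matrix_mul_rid mult_1)

lemma SU_adjoint: "X \<in> SU \<Longrightarrow> adjoint_mat X \<in> SU"
  using SU_adjoint_right by (auto simp: SU_def det_adjoint_mat)

lemma norm_SU_mult_left: "U \<in> SU \<Longrightarrow> norm (U ** A) = norm A" for A :: "'n::finite cmat"
  by (simp add: norm_isometry_mult SU_adjoint_left)

lemma norm_SU_mult_right: "U \<in> SU \<Longrightarrow> norm (A ** U) = norm A" for A :: "'n::finite cmat"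
  by (metis SU_adjoint adjoint_mat_mult norm_SU_mult_left norm_adjoint_mat)

lemma norm_SU: "U \<in> SU \<Longrightarrow> norm U = norm (mat 1 :: 'n cmat)" for U :: "'n::finite cmat"
  by (metis matrix_mul_rid norm_SU_mult_left)

lemma SU_column_norm:
  assumes "U \<in> SU" shows "(\<Sum>k\<in>UNIV. (cmod (U $ k $ a))\<^sup>2) = 1"
proof -
  have "complex_of_real (\<Sum>k\<in>UNIV. (cmod (U $ k $ a))\<^sup>2) = (adjoint_mat U ** U) $ a $ a"
    unfolding of_real_sum complex_norm_square by (simp add: matrix_matrix_mult_def mult.commute)
  also have "\<dots> = of_real 1" using SU_adjoint_left[OF assms] by (simp add: mat_def)
  finally show ?thesis by (simp only: of_real_eq_iff)
qed

lemma cmod_SU_entry_le_one: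
  assumes "U \<in> SU" shows "cmod (U $ k $ a) \<le> 1"
proof -
  have "(cmod (U $ k $ a))\<^sup>2 \<le> (\<Sum>k\<in>UNIV. (cmod (U $ k $ a))\<^sup>2)"
    by (rule member_le_sum) simp_all
  then show ?thesis by (simp add: SU_column_norm[OF assms] abs_square_le_1)
qed

lemma closed_SU: "closed (SU :: 'n::finite cmat set)"
proof -
  have "closed {X :: 'n cmat. adjoint_mat X ** X = mat 1}"
    by (intro closed_Collect_eq matmul.continuous_on continuous_on_const continuous_on_id
        bounded_linear.continuous_on[OF bounded_linear_adjoint_mat])
  moreover have "closed {X :: 'n cmat. det X = 1}"
    by (intro closed_Collect_eq continuous_on_const continuous_on_det)
  ultimately show ?thesis
    unfolding SU_def by (rule closed_Collect_conj)
qed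

lemma compact_SU: "compact (SU :: 'n::finite cmat set)"
  unfolding compact_eq_bounded_closed bounded_iff
  using closed_SU norm_SU by (metis order_refl)

lemma mexp_minus_su: "A \<in> su \<Longrightarrow> mexp (- A) = adjoint_mat (mexp A)"
  by (simp add: in_su_iff adjoint_mexp)

lemma mexp_in_SU:
  assumes "A \<in> su" shows "mexp A \<in> SU"
proof -
  have "adjoint_mat (mexp A) ** mexp A = mat 1"
    unfolding mexp_minus_su[OF assms, symmetric] using mexp_minus_inverse[of "- A"] by simp
  moreover have "det (mexp A) = 1" using assms by (simp add: det_mexp in_su_iff)
  ultimately show ?thesis by (simp add: SU_def)
qed

lemma su_conj:
  assumes "U \<in> SU" "A \<in> su" shows "U ** A ** adjoint_mat U \<in> su"
proof -
  have "trace (U ** A ** adjoint_mat U) = trace (adjoint_mat U ** U ** A)"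
    by (metis matrix_mul_assoc trace_mul_sym)
  then show ?thesis
    using assms by (simp add: in_su_iff SU_adjoint_left adjoint_mat_mult matrix_mul_assoc
        matmul.minus_right matmul.minus_left)
qed

section \<open>Brackets with skew-Hermitian matrix units\<close>

abbreviation commutator :: "'n::finite cmat \<Rightarrow> 'n cmat \<Rightarrow> 'n cmat" where
  "commutator A B \<equiv> A ** B - B ** A"

abbreviation ad_square :: "'n::finite cmat \<Rightarrow> 'n cmat \<Rightarrow> 'n cmat" where
  "ad_square x X \<equiv> commutator x (commutator x X)"

lemma ad_square_eq:
  fixes x X :: "'n::finite cmat"
  shows "ad_square x X = x ** x ** X + X ** x ** x - 2 *\<^sub>R (x ** X ** x)"
  by (simp only: matmul.diff_left matmul.diff_right matrix_mul_assoc scaleR_2 algebra_simps)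

text \<open>If \<open>x\<^sup>3 = - x\<close>, then left and right multiplication by \<open>x\<close> have eigenvalues \<open>0, \<i>, - \<i>\<close>, so the square
  \<open>T\<close> of \<open>ad x\<close> has eigenvalues \<open>0, - 1, - 4\<close>. Up to factors, \<open>T\<^sup>2 + 4 T\<close> and \<open>T\<^sup>2 + T\<close> are therefore the
  spectral projections for \<open>- 1\<close> and \<open>- 4\<close>.\<close>

lemma ad_square_ad_square:
  fixes x X :: "'n::finite cmat"
  assumes "x ** x ** x = - x"
  shows "ad_square x (ad_square x X) =
    6 *\<^sub>R (x ** x ** X ** x ** x) + 8 *\<^sub>R (x ** X ** x) - x ** x ** X - X ** x ** x"
proof -
  have cube: "A ** x ** x ** x = - (A ** x)" for A :: "'n cmat"
  proof -
    have "A ** (x ** x ** x) = A ** (- x)" using assms by (rule arg_cong)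
    then show ?thesis by (simp add: matrix_mul_assoc matmul.minus_right)
  qed
  show ?thesis
    unfolding ad_square_eq
    by (simp only: matmul.add_left matmul.add_right matmul.diff_left matmul.diff_right
        matmul.minus_left matmul.minus_right matmul.scaleR_left matmul.scaleR_right
        matrix_mul_assoc cube assms) (simp add: vec_eq_iff scaleR_conv_of_real[where 'a=complex])
qed

definition coord_proj :: "'n set \<Rightarrow> 'n::finite cmat" where
  "coord_proj J = (\<chi> k l. if k = l \<and> k \<in> J then 1 else 0)"

lemma coord_proj_entry: "coord_proj J $ k $ l = (if k = l \<and> k \<in> J then 1 else 0)"
  by (simp add: coord_proj_def)

lemma adjoint_coord_proj [simp]: "adjoint_mat (coord_proj J) = coord_proj J"
  by (simp add: vec_eq_iff coord_proj_entry)

lemma coord_proj_UNIV [simp]: "coord_proj UNIV = mat 1"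
  by (simp add: vec_eq_iff coord_proj_entry mat_def)

lemma coord_proj_empty [simp]: "coord_proj {} = 0"
  by (simp add: vec_eq_iff coord_proj_entry)

lemma coord_proj_mult_entry: "(coord_proj J ** X) $ k $ l = (if k \<in> J then X $ k $ l else 0)"
  by (simp add: diagonal_mult_entry coord_proj_entry)

lemma mult_coord_proj_entry: "(X ** coord_proj J) $ k $ l = (if l \<in> J then X $ k $ l else 0)"
  by (simp add: mult_diagonal_entry coord_proj_entry)

definition skew_unit :: "complex \<Rightarrow> 'n::finite \<Rightarrow> 'n \<Rightarrow> 'n cmat" where
  "skew_unit z a b = (\<chi> k l. if k = a \<and> l = b then z else if k = b \<and> l = a then - cnj z else 0)"

lemma skew_unit_entry:
  "skew_unit z a b $ k $ l = (if k = a \<and> l = b then z else if k = b \<and> l = a then - cnj z else 0)"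
  by (simp add: skew_unit_def)

lemma Bmat_eq_skew_unit: "a \<noteq> b \<Longrightarrow> Bmat a b = skew_unit 1 a b"
  by (auto simp: Bmat_def Emat_def skew_unit_def vec_eq_iff)

lemma Cmat_eq_skew_unit: "a \<noteq> b \<Longrightarrow> Cmat a b = skew_unit \<i> a b"
  by (auto simp: Cmat_def Emat_def skew_unit_def vec_eq_iff)

lemma Dmat_entry:
  "Dmat a b $ k $ l = (if k = l then \<i> * ((if k = a then 1 else 0) - (if k = b then 1 else 0)) else 0)"
  by (auto simp: Dmat_def Emat_def)

lemma Dmat_swap: "Dmat b a = - Dmat a b"
  by (simp add: vec_eq_iff Dmat_entry)

lemma skew_unit_scaleR: "skew_unit (of_real r * z) a b = r *\<^sub>R skew_unit z a b"
  unfolding vec_eq_iff vector_scaleR_component skew_unit_entry scaleR_conv_of_real[where 'a=complex]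
  by simp

lemma skew_unit_minus: "skew_unit (- z) a b = - skew_unit z a b"
  by (simp add: vec_eq_iff skew_unit_entry)

lemma skew_unit_add: "a \<noteq> b \<Longrightarrow> skew_unit (z + w) a b = skew_unit z a b + skew_unit w a b"
  by (auto simp: vec_eq_iff skew_unit_entry)

lemma skew_unit_swap: "a \<noteq> b \<Longrightarrow> skew_unit (cnj z) b a = - skew_unit z a b"
  by (auto simp: vec_eq_iff skew_unit_entry)

lemma skew_hermitian_skew_unit: "a \<noteq> b \<Longrightarrow> skew_hermitian (skew_unit z a b)"
  by (auto simp: vec_eq_iff skew_unit_entry)

lemma skew_unit_in_su: "a \<noteq> b \<Longrightarrow> skew_unit z a b \<in> su"
  by (simp add: in_su_iff skew_hermitian_skew_unit) (auto simp: trace_def skew_unit_entry intro!: sum.neutral)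

lemma Dmat_in_su: "Dmat a b \<in> su"
  by (simp add: in_su_iff vec_eq_iff trace_def Dmat_entry sum_subtractf flip: sum_distrib_left)

lemma skew_unit_mult_coord_proj: "a \<notin> J \<Longrightarrow> b \<notin> J \<Longrightarrow> skew_unit z a b ** coord_proj J = 0"
  by (auto simp: vec_eq_iff mult_coord_proj_entry skew_unit_entry)

lemma Dmat_mult_coord_proj: "a \<notin> J \<Longrightarrow> b \<notin> J \<Longrightarrow> Dmat a b ** coord_proj J = 0"
  by (auto simp: vec_eq_iff mult_coord_proj_entry Dmat_entry)

lemma skew_unit_mult_entry:
  fixes X :: "'n::finite cmat"
  assumes "a \<noteq> b"
  shows "(skew_unit z a b ** X) $ k $ l =
      (if k = a then z * X $ b $ l else if k = b then - cnj z * X $ a $ l else 0)"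
proof -
  have "(skew_unit z a b ** X) $ k $ l = (\<Sum>m\<in>UNIV.
      (if m = b then if k = a then z * X $ b $ l else 0 else 0) +
      (if m = a then if k = b then - cnj z * X $ a $ l else 0 else 0))"
    unfolding matrix_matrix_mult_def vec_lambda_beta
    by (rule sum.cong) (use assms in \<open>auto simp: skew_unit_entry\<close>)
  then show ?thesis using assms by (simp add: sum.distrib)
qed

lemma mult_skew_unit_entry:
  fixes X :: "'n::finite cmat"
  assumes "a \<noteq> b"
  shows "(X ** skew_unit z a b) $ k $ l =
      (if l = b then X $ k $ a * z else if l = a then - X $ k $ b * cnj z else 0)"
proof -
  have "X ** skew_unit z a b = - adjoint_mat (skew_unit z a b ** adjoint_mat X)"
    using assms by (simp add: adjoint_mat_mult skew_hermitian_skew_unit matmul.minus_right)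
  then show ?thesis using assms by (simp add: skew_unit_mult_entry)
qed

lemma Dmat_mult_entry:
  "(Dmat a b ** X) $ k $ l = \<i> * ((if k = a then 1 else 0) - (if k = b then 1 else 0)) * X $ k $ l"
  by (simp add: diagonal_mult_entry Dmat_entry)

lemma commutator_skew_unit:
  assumes "distinct [a, b, c]"
  shows "commutator (skew_unit z a b) (skew_unit w b c) = skew_unit (z * w) a c"
proof -
  have "commutator (skew_unit z a b) (skew_unit w b c) $ k $ l = skew_unit (z * w) a c $ k $ l" for k l
    by (cases "k = a"; cases "k = b"; cases "k = c"; cases "l = a"; cases "l = b"; cases "l = c")
      (use assms in \<open>simp_all add: skew_unit_mult_entry skew_unit_entry\<close>)
  then show ?thesis by (simp add: vec_eq_iff)
qed

lemma commutator_skew_unit_Dmat: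
  assumes "a \<noteq> b"
  shows "commutator (skew_unit e a b) (Dmat a b) = (- 2) *\<^sub>R skew_unit (\<i> * e) a b"
  using assms
  by (auto simp: vec_eq_iff skew_unit_mult_entry mult_skew_unit_entry skew_unit_entry Dmat_entry
      scaleR_conv_of_real[where 'a=complex])

lemma commutator_skew_unit_rotated:
  assumes "a \<noteq> b" "e * cnj e = 1"
  shows "commutator (skew_unit e a b) (skew_unit (\<i> * e) a b) = 2 *\<^sub>R Dmat a b"
  using assms
  by (auto simp: vec_eq_iff skew_unit_mult_entry mult_skew_unit_entry skew_unit_entry Dmat_entry
      scaleR_conv_of_real[where 'a=complex] algebra_simps)

lemma skew_unit_square:
  assumes "a \<noteq> b" "e * cnj e = 1"
  shows "skew_unit e a b ** skew_unit e a b = - coord_proj {a, b}"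
  using assms
  by (auto simp: vec_eq_iff skew_unit_mult_entry skew_unit_entry coord_proj_entry mult.commute)

lemma skew_unit_cube:
  assumes "a \<noteq> b" "e * cnj e = 1"
  shows "skew_unit e a b ** skew_unit e a b ** skew_unit e a b = - skew_unit e a b"
  unfolding skew_unit_square[OF assms]
  by (auto simp: vec_eq_iff coord_proj_mult_entry skew_unit_entry matmul.minus_left)

lemma mult_skew_unit_skew_unit:
  fixes A :: "'n::finite cmat"
  assumes "a \<noteq> b" "e * cnj e = 1"
  shows "A ** skew_unit e a b ** skew_unit e a b = - (A ** coord_proj {a, b})"
  by (simp add: skew_unit_square[OF assms] matmul.minus_right flip: matrix_mul_assoc)

definition mixed_part :: "'n set \<Rightarrow> 'n::finite cmat \<Rightarrow> 'n cmat" where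
  "mixed_part J X = (\<chi> k l. if (k \<in> J) \<noteq> (l \<in> J) then X $ k $ l else 0)"

lemma mixed_part_eq_ad_square:
  assumes "a \<noteq> b" "e * cnj e = 1"
  defines "x \<equiv> skew_unit e a b"
  shows "ad_square x (ad_square x X) + 4 *\<^sub>R ad_square x X = (- 3) *\<^sub>R mixed_part {a, b} X"
  unfolding x_def ad_square_ad_square[OF skew_unit_cube[OF assms(1,2)]]
  unfolding ad_square_eq mult_skew_unit_skew_unit[OF assms(1,2)] skew_unit_square[OF assms(1,2)]
  by (auto simp: vec_eq_iff mixed_part_def coord_proj_mult_entry mult_coord_proj_entry
      matmul.minus_left matmul.minus_right scaleR_conv_of_real[where 'a=complex])

lemma skew_hermitian_block:
  assumes "a \<noteq> b" "e * cnj e = 1" "skew_hermitian B"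
  shows "coord_proj {a, b} ** B ** coord_proj {a, b} + skew_unit e a b ** B ** skew_unit e a b =
    (2 * Im (cnj e * B $ a $ b)) *\<^sub>R skew_unit (\<i> * e) a b
    + (Im (B $ a $ a) - Im (B $ b $ b)) *\<^sub>R Dmat a b" (is "?l = ?r")
proof -
  have unit: "e * (cnj e * z) = z" "cnj e * (e * z) = z" for z
    using assms(2) by (simp_all add: mult.left_commute flip: mult.assoc)
  obtain r p where rp: "cnj e * B $ a $ b = of_real r + \<i> * of_real p" "Im (cnj e * B $ a $ b) = p"
    using complex_eq by metis
  have ab: "B $ a $ b = e * (of_real r + \<i> * of_real p)"
    unfolding rp(1)[symmetric] unit ..
  have ba: "B $ b $ a = cnj e * (\<i> * of_real p - of_real r)"
    unfolding skew_hermitian_entry[OF assms(3), of b a] ab by (simp add: algebra_simps)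
  have diag: "B $ c $ c = \<i> * of_real (Im (B $ c $ c))" for c
    using Re_skew_hermitian_diag[OF assms(3), of c] by (simp add: complex_eq_iff)
  have "?l $ k $ l = ?r $ k $ l" for k l
    unfolding rp(2) using assms(1) diag[of a] diag[of b]
    by (auto simp: coord_proj_mult_entry mult_coord_proj_entry skew_unit_mult_entry
        mult_skew_unit_entry skew_unit_entry Dmat_entry ab ba unit
        scaleR_conv_of_real[where 'a=complex] algebra_simps)
  then show ?thesis by (simp add: vec_eq_iff)
qed

lemma skew_hermitian_block_eq_ad_square:
  assumes "a \<noteq> b" "e * cnj e = 1" "skew_hermitian B"
  defines "x \<equiv> skew_unit e a b"
  shows "ad_square x (ad_square x B) + ad_square x B =
    (12 * Im (cnj e * B $ a $ b)) *\<^sub>R skew_unit (\<i> * e) a b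
    + (6 * (Im (B $ a $ a) - Im (B $ b $ b))) *\<^sub>R Dmat a b"
proof -
  have "ad_square x (ad_square x B) + ad_square x B
      = 6 *\<^sub>R (coord_proj {a, b} ** B ** coord_proj {a, b} + x ** B ** x)"
    unfolding x_def ad_square_ad_square[OF skew_unit_cube[OF assms(1,2)]]
    unfolding ad_square_eq mult_skew_unit_skew_unit[OF assms(1,2)] skew_unit_square[OF assms(1,2)]
    by (simp add: vec_eq_iff matmul.minus_left matmul.minus_right
        scaleR_conv_of_real[where 'a=complex])
  then show ?thesis
    unfolding x_def skew_hermitian_block[OF assms(1-3)] by (simp add: scaleR_add_right)
qed

lemma mixed_part_mixed_part_entry:
  assumes "distinct [a, b, c]"
  shows "mixed_part {a, b} (mixed_part {a, c} X) $ k $ l =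
    (if k = a \<and> l \<notin> {a, b, c} \<or> l = a \<and> k \<notin> {a, b, c} \<or> k = b \<and> l = c \<or> k = c \<and> l = b
     then X $ k $ l else 0)"
  using assms by (cases "k = a"; cases "l = a"; auto simp: mixed_part_def)

lemma mixed_part_fourfold_eq_skew_unit:
  assumes "distinct [a, b, c, a', b', c']" "skew_hermitian B"
  shows "mixed_part {a, b} (mixed_part {a, c} (mixed_part {a', b'} (mixed_part {a', c'} B)))
    = skew_unit (B $ a $ a') a a'" (is "?l = _")
proof -
  have "distinct [a, b, c]" "distinct [a', b', c']" using assms(1) by auto
  then have "?l $ k $ l = skew_unit (B $ a $ a') a a' $ k $ l" for k l
    using assms(1) skew_hermitian_entry[OF assms(2), of a' a]
    by (simp only: mixed_part_mixed_part_entry skew_unit_entry) auto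
  then show ?thesis by (simp add: vec_eq_iff)
qed

section \<open>Lie algebras containing many matrix units\<close>

lemma skew_unit_sum_entry:
  assumes "skew_hermitian A"
  shows "(\<Sum>c\<in>UNIV. \<Sum>d\<in>UNIV. if c = d then 0 else (1/2) *\<^sub>R skew_unit (A $ c $ d) c d) $ k $ l
    = (if k = l then 0 else A $ k $ l)" (is "?P $ k $ l = _")
proof (cases "k = l")
  case True
  then show ?thesis
    unfolding sum_component
    by (simp, intro sum.neutral ballI) (auto simp: skew_unit_entry)
next
  case False
  have "?P $ k $ l = (\<Sum>c\<in>UNIV. \<Sum>d\<in>UNIV.
      (if d = l then if c = k then A $ k $ l / 2 else 0 else 0) +
      (if d = k then if c = l then - cnj (A $ l $ k) / 2 else 0 else 0))"
    unfolding sum_component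
    by (intro sum.cong refl)
      (use False in \<open>auto simp: skew_unit_entry scaleR_conv_of_real[where 'a=complex]\<close>)
  also have "\<dots> = A $ k $ l / 2 + - cnj (A $ l $ k) / 2"
    by (simp add: sum.distrib)
  also have "- cnj (A $ l $ k) = A $ k $ l"
    using skew_hermitian_entry[OF assms, of k l] by simp
  finally show ?thesis using False by simp
qed

lemma Dmat_sum_entry:
  assumes "(\<Sum>c\<in>UNIV. x c) = 0"
  shows "(\<Sum>c\<in>UNIV. x c *\<^sub>R Dmat c a) $ k $ l = (if k = l then \<i> * of_real (x k) else 0)"
proof -
  have "(\<Sum>c\<in>UNIV. x c *\<^sub>R Dmat c a) $ k $ l = (if k = l then
      (\<Sum>c\<in>UNIV. \<i> * (if c = k then of_real (x k) else 0)
        - (\<i> * (if k = a then 1 else 0)) * of_real (x c))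
      else 0)"
    unfolding sum_component
    by (auto simp: Dmat_entry scaleR_conv_of_real[where 'a=complex] algebra_simps intro!: sum.cong)
  also have "\<dots> = (if k = l then
      \<i> * of_real (x k) - (\<i> * (if k = a then 1 else 0)) * of_real (\<Sum>c\<in>UNIV. x c) else 0)"
    by (simp add: sum_subtractf flip: sum_distrib_left)
  finally show ?thesis using assms by simp
qed

lemma su_eq_sum_generators:
  assumes "A \<in> su"
  shows "A = (\<Sum>c\<in>UNIV. \<Sum>d\<in>UNIV. if c = d then 0 else (1/2) *\<^sub>R skew_unit (A $ c $ d) c d)
    + (\<Sum>c\<in>UNIV. Im (A $ c $ c) *\<^sub>R Dmat c a)"
proof -
  have skew: "skew_hermitian A" and "trace A = 0" using assms by (auto simp: in_su_iff)
  then have trace: "(\<Sum>c\<in>UNIV. Im (A $ c $ c)) = 0" by (simp add: trace_def flip: Im_sum)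
  have diagonal: "A $ k $ k = \<i> * of_real (Im (A $ k $ k))" for k
    using Re_skew_hermitian_diag[OF skew, of k] by (simp add: complex_eq_iff)
  show ?thesis
    unfolding vec_eq_iff vector_add_component skew_unit_sum_entry[OF skew] Dmat_sum_entry[OF trace]
    using diagonal by auto
qed

locale lie_algebra =
  fixes L :: "'n::finite cmat set"
  assumes subspace: "subspace L"
    and commutator_closed: "A \<in> L \<Longrightarrow> B \<in> L \<Longrightarrow> commutator A B \<in> L"
begin

lemma skew_unit_trans:
  assumes "skew_unit z a b \<in> L" "skew_unit w b c \<in> L" "distinct [a, b, c]"
  shows "skew_unit (z * w) a c \<in> L"
  using commutator_closed[OF assms(1,2)] commutator_skew_unit[OF assms(3)] by simp

lemma skew_unit_minus_iff: "skew_unit (- z) a b \<in> L \<longleftrightarrow> skew_unit z a b \<in> L"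
  using subspace_neg[OF subspace] by (metis minus_minus skew_unit_minus)

lemma skew_unit_swap_iff: "a \<noteq> b \<Longrightarrow> skew_unit (cnj z) b a \<in> L \<longleftrightarrow> skew_unit z a b \<in> L"
  using subspace_neg[OF subspace] by (metis minus_minus skew_unit_swap)

lemma skew_unit_of_real_mult_iff:
  assumes "r \<noteq> 0"
  shows "skew_unit (of_real r * z) a b \<in> L \<longleftrightarrow> skew_unit z a b \<in> L"
  unfolding skew_unit_scaleR
  using subspace_scale[OF subspace, of "r *\<^sub>R skew_unit z a b" "inverse r"]
    subspace_scale[OF subspace, of "skew_unit z a b" r] assms by auto

lemma mixed_part_in:
  assumes "a \<noteq> b" "e * cnj e = 1" "skew_unit e a b \<in> L" "X \<in> L"
  shows "mixed_part {a, b} X \<in> L"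
proof -
  have ad_square: "ad_square (skew_unit e a b) Y \<in> L" if "Y \<in> L" for Y
    by (intro commutator_closed assms(3) that)
  then have "(- 3) *\<^sub>R mixed_part {a, b} X \<in> L"
    unfolding mixed_part_eq_ad_square[OF assms(1,2), symmetric]
    by (intro subspace_add[OF subspace] subspace_scale[OF subspace] ad_square assms(4))
  from subspace_scale[OF subspace this, of "- 1 / 3"] show ?thesis by simp
qed

definition linked :: "'n \<Rightarrow> 'n \<Rightarrow> bool" where
  "linked a b \<longleftrightarrow> a \<noteq> b \<and> (skew_unit 1 a b \<in> L \<or> skew_unit \<i> a b \<in> L)"

definition full :: "'n \<Rightarrow> 'n \<Rightarrow> bool" where
  "full a b \<longleftrightarrow> a \<noteq> b \<and> (\<forall>z. skew_unit z a b \<in> L)"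

lemma full_sym: "full a b \<Longrightarrow> full b a"
  unfolding full_def by (metis complex_cnj_cnj skew_unit_swap_iff)

lemma linkedE:
  assumes "linked a b"
  obtains e where "a \<noteq> b" "e \<in> {1, \<i>}" "e * cnj e = 1" "skew_unit e a b \<in> L"
  using assms that[of 1] that[of \<i>] by (auto simp: linked_def)

lemma linked_trans:
  assumes "linked a b" "linked b c" "a \<noteq> c"
  shows "linked a c"
proof -
  obtain e where e: "a \<noteq> b" "e \<in> {1, \<i>}" "skew_unit e a b \<in> L" using assms(1) by (rule linkedE)
  obtain d where d: "b \<noteq> c" "d \<in> {1, \<i>}" "skew_unit d b c \<in> L" using assms(2) by (rule linkedE)
  have "skew_unit (e * d) a c \<in> L"
    using assms(3) e(1) d(1) by (intro skew_unit_trans[OF e(3) d(3)]) simp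
  then show ?thesis
    using e(2) d(2) assms(3) skew_unit_minus_iff[of 1 a c] by (auto simp: linked_def)
qed

lemma full_linked_trans:
  assumes "full a b" "linked b c" "a \<noteq> c"
  shows "full a c"
proof -
  obtain e where e: "b \<noteq> c" "e * cnj e = 1" "skew_unit e b c \<in> L" using assms(2) by (rule linkedE)
  have "skew_unit z a c \<in> L" for z
  proof -
    have "skew_unit (z * cnj e * e) a c \<in> L"
      using assms e by (intro skew_unit_trans[of "z * cnj e" a b e c]) (auto simp: full_def)
    moreover have "z * cnj e * e = z" using e(2) by (simp add: mult.commute mult.left_commute)
    ultimately show ?thesis by simp
  qed
  then show ?thesis using assms(3) by (simp add: full_def)
qed

lemma linked_if_isolated_entry:
  assumes "distinct [a, b, c, a', b', c']"
    and "linked a b" "linked a c" "linked a' b'" "linked a' c'"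
    and B: "B \<in> L" "skew_hermitian B"
    and entry: "B $ a $ a' \<noteq> 0" "Re (B $ a $ a') = 0 \<or> Im (B $ a $ a') = 0"
  shows "linked a a'"
proof -
  have mixed: "mixed_part {p, q} X \<in> L" if "linked p q" "X \<in> L" for p q X
    using that(1) by (rule linkedE) (rule mixed_part_in[OF _ _ _ that(2)])
  have "skew_unit (B $ a $ a') a a' \<in> L"
    unfolding mixed_part_fourfold_eq_skew_unit[OF assms(1) B(2), symmetric]
    by (intro mixed assms B)
  moreover have "\<exists>r e. r \<noteq> 0 \<and> e \<in> {1, \<i>} \<and> B $ a $ a' = of_real r * e"
  proof (cases "Re (B $ a $ a') = 0")
    case True
    then show ?thesis
      using entry(1) by (intro exI[of _ "Im (B $ a $ a')"] exI[of _ \<i>]) (simp add: complex_eq_iff)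
  next
    case False
    then show ?thesis
      using entry(2) by (intro exI[of _ "Re (B $ a $ a')"] exI[of _ 1]) (simp add: complex_eq_iff)
  qed
  ultimately show ?thesis
    using assms(1) skew_unit_of_real_mult_iff[of _ 1]
    by (auto simp: linked_def skew_unit_of_real_mult_iff)
qed

lemma fullI:
  assumes "a \<noteq> b" "skew_unit 1 a b \<in> L" "skew_unit \<i> a b \<in> L"
  shows "full a b"
  unfolding full_def
proof (intro conjI allI)
  fix z
  have "skew_unit z a b = skew_unit (of_real (Re z) * 1 + of_real (Im z) * \<i>) a b"
    by (metis complex_eq mult.commute mult.right_neutral)
  also have "\<dots> = Re z *\<^sub>R skew_unit 1 a b + Im z *\<^sub>R skew_unit \<i> a b"
    by (simp only: skew_unit_add[OF assms(1)] skew_unit_scaleR)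
  finally show "skew_unit z a b \<in> L"
    using assms subspace by (simp add: subspace_add subspace_scale)
qed fact

text \<open>With \<open>x = skew_unit e a b\<close> and \<open>y = skew_unit (\<i> * e) a b\<close>, bracketing with \<open>x\<close> rotates the plane
  spanned by \<open>y\<close> and \<open>Dmat a b\<close>, so every nonzero element of that plane generates all of it.\<close>

lemma full_if_block:
  assumes "a \<noteq> b" "e \<in> {1, \<i>}" "skew_unit e a b \<in> L"
    and G: "p *\<^sub>R skew_unit (\<i> * e) a b + q *\<^sub>R Dmat a b \<in> L" and nonzero: "p \<noteq> 0 \<or> q \<noteq> 0"
  shows "full a b"
proof -
  define x y D where "x = skew_unit e a b" and "y = skew_unit (\<i> * e) a b" and "D = Dmat a b"
  have "e * cnj e = 1" using assms(2) by auto
  from commutator_skew_unit_rotated[OF assms(1) this] commutator_skew_unit_Dmat[OF assms(1), of e]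
  have "commutator x y = 2 *\<^sub>R D" "commutator x D = (- 2) *\<^sub>R y"
    unfolding x_def y_def D_def .
  moreover have "commutator x (p *\<^sub>R y + q *\<^sub>R D) = p *\<^sub>R commutator x y + q *\<^sub>R commutator x D"
    by (simp add: matmul.add_right matmul.add_left matmul.scaleR_right matmul.scaleR_left
        algebra_simps)
  ultimately have bracket: "(2 * p) *\<^sub>R D - (2 * q) *\<^sub>R y \<in> L"
    using commutator_closed[OF assms(3) G] unfolding x_def y_def D_def by (simp add: mult.commute)
  have "p *\<^sub>R (p *\<^sub>R y + q *\<^sub>R D) - (q / 2) *\<^sub>R ((2 * p) *\<^sub>R D - (2 * q) *\<^sub>R y) \<in> L"
    using subspace_diff[OF subspace subspace_scale[OF subspace G] subspace_scale[OF subspace bracket]]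
    by (simp only: y_def D_def)
  then have "(p\<^sup>2 + q\<^sup>2) *\<^sub>R y \<in> L"
    by (simp add: algebra_simps power2_eq_square)
  moreover have "p\<^sup>2 + q\<^sup>2 \<noteq> 0" using nonzero by (simp add: sum_power2_eq_zero_iff)
  ultimately have "y \<in> L"
    using subspace_scale[OF subspace, of _ "inverse (p\<^sup>2 + q\<^sup>2)"] by fastforce
  then show ?thesis
    using assms(1-3) skew_unit_minus_iff[of 1 a b] by (intro fullI) (auto simp: y_def)
qed

lemma full_if_Dmat:
  assumes "linked a b" "Dmat a b \<in> L"
  shows "full a b"
  using assms(1)
proof (rule linkedE)
  fix e assume "a \<noteq> b" "e \<in> {1, \<i>}" "skew_unit e a b \<in> L"
  then show ?thesis using full_if_block[of a b e 0 1] assms(2) by simp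
qed

lemma aligned_if_not_full:
  assumes "a \<noteq> b" "e \<in> {1, \<i>}" "skew_unit e a b \<in> L"
    and B: "B \<in> L" "skew_hermitian B" and "\<not> full a b"
  shows "Im (cnj e * B $ a $ b) = 0" "Im (B $ a $ a) = Im (B $ b $ b)"
proof -
  have ad_square: "ad_square (skew_unit e a b) X \<in> L" if "X \<in> L" for X
    by (intro commutator_closed assms(3) that)
  have unit: "e * cnj e = 1" using assms(2) by auto
  have "(12 * Im (cnj e * B $ a $ b)) *\<^sub>R skew_unit (\<i> * e) a b
      + (6 * (Im (B $ a $ a) - Im (B $ b $ b))) *\<^sub>R Dmat a b \<in> L"
    unfolding skew_hermitian_block_eq_ad_square[OF assms(1) unit B(2), symmetric]
    by (intro subspace_add[OF subspace] ad_square B(1))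
  from full_if_block[OF assms(1-3) this] assms(6)
  show "Im (cnj e * B $ a $ b) = 0" "Im (B $ a $ a) = Im (B $ b $ b)" by auto
qed

lemma all_full_if_full:
  assumes linked: "\<And>c d. c \<noteq> d \<Longrightarrow> linked c d" and "full a b" and "c \<noteq> d"
  shows "full c d"
proof -
  have from_a: "full a v" if "v \<noteq> a" for v
    using full_linked_trans[OF \<open>full a b\<close> linked] \<open>full a b\<close> that by metis
  show ?thesis
  proof (cases "c = a \<or> d = a")
    case True
    then show ?thesis using from_a full_sym \<open>c \<noteq> d\<close> by metis
  next
    case False
    then show ?thesis
      using full_linked_trans[OF full_sym[OF from_a[of c]] linked[of a d] \<open>c \<noteq> d\<close>] by metis
  qed
qed

lemma Dmat_in_if_full:
  assumes "full a b" shows "Dmat a b \<in> L"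
proof -
  have "a \<noteq> b" "skew_unit 1 a b \<in> L" "skew_unit \<i> a b \<in> L" using assms by (auto simp: full_def)
  then have "2 *\<^sub>R Dmat a b \<in> L"
    using commutator_closed commutator_skew_unit_rotated[of a b 1] by fastforce
  from subspace_scale[OF subspace this, of "1/2"] show ?thesis by simp
qed

lemma su_subset_if_full:
  assumes "\<And>c d. c \<noteq> d \<Longrightarrow> linked c d" and "full a b"
  shows "su \<subseteq> L"
proof
  have full: "full c d" if "c \<noteq> d" for c d
    by (rule all_full_if_full[OF assms that])
  have D: "Dmat c a \<in> L" for c
  proof (cases "c = a")
    case True
    then have "Dmat c a = 0" by (simp add: vec_eq_iff Dmat_entry)
    then show ?thesis using subspace_0[OF subspace] by simp
  qed (use Dmat_in_if_full full in blast)
  fix A :: "'n cmat"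
  assume "A \<in> su"
  then show "A \<in> L"
    using full subspace_0[OF subspace]
    by (subst su_eq_sum_generators[of A a])
      (auto intro!: subspace_add[OF subspace] subspace_sum[OF subspace] subspace_scale[OF subspace] D
        simp: full_def)
qed

end

section \<open>Edge-coloured graphs and generation of the Lie algebra\<close>

lemma generic_pencil:
  fixes A S :: "'a::real_vector" and \<Phi> :: "('a \<Rightarrow> real) set"
  assumes "finite \<Phi>" and linear: "\<And>\<phi>. \<phi> \<in> \<Phi> \<Longrightarrow> linear \<phi>"
  obtains x where "x \<noteq> 0" "\<And>\<phi>. \<phi> \<in> \<Phi> \<Longrightarrow> \<phi> A \<noteq> 0 \<or> \<phi> S \<noteq> 0 \<Longrightarrow> \<phi> (x *\<^sub>R A + S) \<noteq> 0"
proof -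
  obtain x :: real where x: "x \<notin> insert 0 ((\<lambda>\<phi>. - \<phi> S / \<phi> A) ` \<Phi>)"
    using ex_new_if_finite[OF infinite_UNIV_char_0, of "insert 0 ((\<lambda>\<phi>. - \<phi> S / \<phi> A) ` \<Phi>)"] assms(1)
    by auto
  have "\<phi> (x *\<^sub>R A + S) \<noteq> 0" if "\<phi> \<in> \<Phi>" "\<phi> A \<noteq> 0 \<or> \<phi> S \<noteq> 0" for \<phi>
  proof
    assume "\<phi> (x *\<^sub>R A + S) = 0"
    then have zero: "- \<phi> S = x * \<phi> A"
      using linear[OF that(1)] by (simp add: linear_add linear_scale)
    then have "\<phi> A \<noteq> 0" using that(2) by auto
    then have "- \<phi> S / \<phi> A = x" using zero by (metis nonzero_mult_div_cancel_right)
    then show False using x that(1) by blast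
  qed
  then show thesis using that[of x] x by blast
qed

lemma generic_combination:
  fixes As :: "'a::real_vector set" and \<Phi> :: "('a \<Rightarrow> real) set"
  assumes "finite As" and \<Phi>: "finite \<Phi>" "\<And>\<phi>. \<phi> \<in> \<Phi> \<Longrightarrow> linear \<phi>"
  shows "\<exists>l. (\<forall>A\<in>As. l A \<noteq> 0) \<and>
    (\<forall>\<phi>\<in>\<Phi>. (\<exists>A\<in>As. \<phi> A \<noteq> 0) \<longrightarrow> \<phi> (\<Sum>A\<in>As. l A *\<^sub>R A) \<noteq> 0)"
  using assms(1)
proof induction
  case empty
  then show ?case by simp
next
  case (insert A As)
  then obtain l where l: "\<forall>A\<in>As. l A \<noteq> 0"
    "\<And>\<phi>. \<phi> \<in> \<Phi> \<Longrightarrow> \<exists>A\<in>As. \<phi> A \<noteq> 0 \<Longrightarrow> \<phi> (\<Sum>A\<in>As. l A *\<^sub>R A) \<noteq> 0"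
    by blast
  obtain x where x: "x \<noteq> 0" "\<And>\<phi>. \<phi> \<in> \<Phi> \<Longrightarrow> \<phi> A \<noteq> 0 \<or> \<phi> (\<Sum>A\<in>As. l A *\<^sub>R A) \<noteq> 0 \<Longrightarrow>
      \<phi> (x *\<^sub>R A + (\<Sum>A\<in>As. l A *\<^sub>R A)) \<noteq> 0"
    using generic_pencil[OF \<Phi>, where A = A and S = "\<Sum>A\<in>As. l A *\<^sub>R A"] by blast
  have sum: "(\<Sum>A'\<in>insert A As. (l(A := x)) A' *\<^sub>R A') = x *\<^sub>R A + (\<Sum>A\<in>As. l A *\<^sub>R A)"
    using insert.hyps by (simp add: sum.insert) (intro sum.cong, auto)
  have "\<phi> (x *\<^sub>R A + (\<Sum>A\<in>As. l A *\<^sub>R A)) \<noteq> 0" if "\<phi> \<in> \<Phi>" "\<exists>A'\<in>insert A As. \<phi> A' \<noteq> 0" for \<phi>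
    using x(2) l(2) that by blast
  moreover have "\<forall>A'\<in>insert A As. (l(A := x)) A' \<noteq> 0"
    using l(1) x(1) by auto
  ultimately show ?case unfolding sum[symmetric] by blast
qed

lemma skew_hermitian_entry_parts:
  assumes "A \<in> su"
  shows "Re (A $ i $ j) = - Re (A $ j $ i)" "Im (A $ i $ j) = Im (A $ j $ i)"
  using skew_hermitian_entry[of A i j] assms by (simp_all add: in_su_iff)

lemma drift_edges_su:
  assumes "As \<subseteq> su"
  shows "drift_edges As = {({i, j}, Blue) | i j. i \<noteq> j \<and> (\<exists>A\<in>As. Re (A $ i $ j) \<noteq> 0)}
    \<union> {({i, j}, Red) | i j. i \<noteq> j \<and> (\<exists>A\<in>As. Im (A $ i $ j) \<noteq> 0)}
    \<union> {({i}, Green) | i. \<exists>A\<in>As. Im (A $ i $ i) \<noteq> 0}"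
proof -
  have "(\<exists>A\<in>As. Re (A $ i $ j) = - Re (A $ j $ i) \<and> Re (A $ i $ j) \<noteq> 0) \<longleftrightarrow> (\<exists>A\<in>As. Re (A $ i $ j) \<noteq> 0)"
    and "(\<exists>A\<in>As. Im (A $ i $ j) = Im (A $ j $ i) \<and> Im (A $ i $ j) \<noteq> 0) \<longleftrightarrow> (\<exists>A\<in>As. Im (A $ i $ j) \<noteq> 0)"
    for i j
    using skew_hermitian_entry_parts assms by blast+
  moreover have "(\<exists>A\<in>As. A $ i $ i \<noteq> 0) \<longleftrightarrow> (\<exists>A\<in>As. Im (A $ i $ i) \<noteq> 0)" for i
  proof (rule bex_cong[OF refl])
    fix A assume "A \<in> As"
    then have "skew_hermitian A" using assms by (auto simp: in_su_iff)
    then have "Re (A $ i $ i) = 0" by (rule Re_skew_hermitian_diag)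
    then show "A $ i $ i \<noteq> 0 \<longleftrightarrow> Im (A $ i $ i) \<noteq> 0" by (simp add: complex_eq_iff)
  qed
  ultimately show ?thesis by (simp only: drift_edges_def)
qed

lemma drift_edge_iff:
  assumes "B \<in> su"
  shows "({u, v}, Blue) \<in> drift_edges {B} \<longleftrightarrow> u \<noteq> v \<and> Re (B $ u $ v) \<noteq> 0"
    and "({u, v}, Red) \<in> drift_edges {B} \<longleftrightarrow> u \<noteq> v \<and> Im (B $ u $ v) \<noteq> 0"
    and "({u, v}, Green) \<in> drift_edges {B} \<longleftrightarrow> u = v \<and> Im (B $ u $ u) \<noteq> 0"
  using skew_hermitian_entry_parts[OF assms, of u v] assms
  by (auto simp: drift_edges_su doubleton_eq_iff)

lemma Re_or_Im_zero_if_no_multi_edge: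
  assumes "B \<in> su" "\<not> has_multi_edge (drift_edges {B})" "u \<noteq> v"
  shows "Re (B $ u $ v) = 0 \<or> Im (B $ u $ v) = 0"
proof (rule ccontr)
  assume "\<not> ?thesis"
  then have "({u, v}, Blue) \<in> drift_edges {B}" "({u, v}, Red) \<in> drift_edges {B}"
    using assms(3) by (simp_all add: drift_edge_iff[OF assms(1)])
  then show False using assms(2) unfolding has_multi_edge_def by blast
qed

lemma Sigma_r_subset_su: "As \<subseteq> su \<Longrightarrow> Sigma_r As \<subseteq> su"
  unfolding Sigma_r_def
  by (auto intro!: subspace_sum[OF subspace_su] subspace_scale[OF subspace_su])

lemma generic_drift_exists:
  fixes As :: "'n::finite cmat set"
  assumes "finite As" "As \<subseteq> su"
  shows "\<exists>B\<in>Sigma_r As. drift_edges {B} = drift_edges As"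
proof -
  define re im :: "'n \<times> 'n \<Rightarrow> 'n cmat \<Rightarrow> real"
    where "re = (\<lambda>(i, j) A. Re (A $ i $ j))" and "im = (\<lambda>(i, j) A. Im (A $ i $ j))"
  have "linear (re p)" "linear (im p)" for p
    by (auto simp: re_def im_def split: prod.split intro!: linearI)
  then have linear: "\<And>\<phi>. \<phi> \<in> range re \<union> range im \<Longrightarrow> linear \<phi>" by auto
  have finite: "finite (range re \<union> range im)" by simp
  obtain l where l: "\<forall>A\<in>As. l A \<noteq> 0"
    "\<And>\<phi>. \<phi> \<in> range re \<union> range im \<Longrightarrow> \<exists>A\<in>As. \<phi> A \<noteq> 0 \<Longrightarrow> \<phi> (\<Sum>A\<in>As. l A *\<^sub>R A) \<noteq> 0"
    using generic_combination[OF assms(1) finite linear] by blast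
  define B where "B = (\<Sum>A\<in>As. l A *\<^sub>R A)"
  have B: "B \<in> Sigma_r As" using l(1) unfolding Sigma_r_def B_def by blast
  have "Re (B $ i $ j) \<noteq> 0 \<longleftrightarrow> (\<exists>A\<in>As. Re (A $ i $ j) \<noteq> 0)" for i j
  proof
    show "Re (B $ i $ j) \<noteq> 0" if "\<exists>A\<in>As. Re (A $ i $ j) \<noteq> 0"
      using l(2)[OF UnI1[OF rangeI], of "(i, j)"] that unfolding re_def B_def by simp
  qed (auto simp: B_def intro: ccontr)
  moreover have "Im (B $ i $ j) \<noteq> 0 \<longleftrightarrow> (\<exists>A\<in>As. Im (A $ i $ j) \<noteq> 0)" for i j
  proof
    show "Im (B $ i $ j) \<noteq> 0" if "\<exists>A\<in>As. Im (A $ i $ j) \<noteq> 0"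
      using l(2)[OF UnI2[OF rangeI], of "(i, j)"] that unfolding im_def B_def by simp
  qed (auto simp: B_def intro: ccontr)
  ultimately have "drift_edges {B} = drift_edges As"
    using Sigma_r_subset_su[OF assms(2)] B assms(2) by (simp add: drift_edges_su subset_iff)
  then show ?thesis using B by blast
qed

lemma sym_adj_rel: "sym (adj_rel E)"
  unfolding adj_rel_def by (simp add: sym_def insert_commute)

lemma two_other_nodes_in_component:
  assumes "\<forall>K\<in>components E. card K \<ge> 3"
  obtains b c where "distinct [u, b, c]" "(u, b) \<in> (adj_rel E)\<^sup>*" "(u, c) \<in> (adj_rel E)\<^sup>*"
proof -
  let ?K = "{v. (u, v) \<in> (adj_rel E)\<^sup>*}"
  have "card ?K \<ge> 3" using assms by (auto simp: components_def)
  then have "2 \<le> card (?K - {u})" by simp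
  then obtain T where "T \<subseteq> ?K - {u}" "card T = 2" by (rule obtain_subset_with_card_n)
  then obtain b c where "{b, c} \<subseteq> ?K - {u}" "b \<noteq> c" by (metis card_2_iff)
  then show thesis using that[of b c] by auto
qed

lemma walk_parity:
  assumes cocycle: "\<And>u v w. red u w \<longleftrightarrow> red u v \<noteq> red v w"
    and edge: "\<And>u v c. ({u, v}, c) \<in> E \<Longrightarrow> red u v \<longleftrightarrow> c = Red"
    and "is_walk E w" "w \<noteq> []"
  shows "odd (num_red w) \<longleftrightarrow> red (fst (hd w)) (snd (snd (last w)))"
  using assms(4,3)
proof (induction w rule: list_nonempty_induct)
  case (single s)
  obtain u e v where s: "s = (u, e, v)" by (metis prod_cases3)
  then have "e \<in> E" "fst e = {u, v}" using single by (auto simp: is_walk_def)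
  then have "red u v \<longleftrightarrow> snd e = Red" by (intro edge) (metis prod.collapse)
  then show ?case by (simp add: num_red_def s)
next
  case (cons s w)
  obtain u e v where s: "s = (u, e, v)" by (metis prod_cases3)
  then have "e \<in> E" "fst e = {u, v}" using cons.prems by (auto simp: is_walk_def)
  then have "red u v \<longleftrightarrow> snd e = Red" by (intro edge) (metis prod.collapse)
  moreover have "is_walk E w"
    using cons.prems unfolding is_walk_def by (auto dest: spec[of _ "Suc _"])
  moreover have "v = fst (hd w)"
    using cons.prems cons.hyps unfolding is_walk_def
    by (auto simp: s hd_conv_nth dest: spec[of _ 0])
  ultimately show ?case
    using cons.IH cons.hyps cocycle[of u "snd (snd (last w))" v] by (auto simp: num_red_def s)
qed

context lie_algebra
begin

definition red :: "'n \<Rightarrow> 'n \<Rightarrow> bool" where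
  "red u v \<longleftrightarrow> u \<noteq> v \<and> skew_unit \<i> u v \<in> L"

lemma red_sym: "red u v \<Longrightarrow> red v u"
  using skew_unit_swap_iff[of u v \<i>] by (auto simp: red_def skew_unit_minus_iff)

context
  assumes linked: "\<And>a b. a \<noteq> b \<Longrightarrow> linked a b" and not_full: "\<And>a b. \<not> full a b"
begin

lemma skew_unit_one_iff_not_red: "u \<noteq> v \<Longrightarrow> skew_unit 1 u v \<in> L \<longleftrightarrow> \<not> red u v"
  using linked[of u v] not_full[of u v] fullI[of u v] by (auto simp: red_def linked_def)

lemma red_cocycle: "red u w \<longleftrightarrow> red u v \<noteq> red v w"
proof (cases "distinct [u, v, w]")
  case False
  then have "u = v \<or> v = w \<or> u = w" by auto
  moreover have "\<not> red x x" for x by (simp add: red_def)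
  ultimately show ?thesis using red_sym by metis
next
  case True
  define axis where "axis x y = (if red x y then \<i> else 1)" for x y
  have axis: "skew_unit (axis x y) x y \<in> L" if "x \<noteq> y" for x y
    using skew_unit_one_iff_not_red[OF that] by (auto simp: axis_def red_def)
  have "skew_unit (axis u v * axis v w) u w \<in> L"
    using True by (intro skew_unit_trans[of _ u v] axis) auto
  then show ?thesis
    using skew_unit_one_iff_not_red[of u w] True skew_unit_minus_iff[of 1 u w]
    by (auto simp: axis_def split: if_splits) (auto simp: red_def)
qed

context
  fixes B
  assumes B: "B \<in> L" "B \<in> su"
begin

lemma diagonal_zero: "B $ a $ a = 0"
proof -
  have skew: "skew_hermitian B" using B(2) by (simp add: in_su_iff)
  have equal_diagonal: "Im (B $ b $ b) = Im (B $ a $ a)" for b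
  proof (cases "b = a")
    case False
    then obtain e where "e \<in> {1, \<i>}" "skew_unit e b a \<in> L" using linked linkedE by metis
    from aligned_if_not_full(2)[OF False this B(1) skew not_full] show ?thesis .
  qed simp
  have "Im (trace B) = (\<Sum>b\<in>(UNIV :: 'n set). Im (B $ a $ a))"
    unfolding trace_def Im_sum by (rule sum.cong[OF refl equal_diagonal])
  then have "Im (B $ a $ a) = 0" using B(2) by (simp add: in_su_iff)
  then show ?thesis using Re_skew_hermitian_diag[OF skew] by (simp add: complex_eq_iff)
qed

lemma entry_on_axis:
  assumes "u \<noteq> v"
  shows "if red u v then Re (B $ u $ v) = 0 else Im (B $ u $ v) = 0"
  using aligned_if_not_full(1)[OF assms, of \<i> B] aligned_if_not_full(1)[OF assms, of 1 B]
    skew_unit_one_iff_not_red[OF assms] not_full B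
  by (auto simp: red_def in_su_iff)

lemma drift_edge_red_iff:
  assumes "({u, v}, c) \<in> drift_edges {B}"
  shows "red u v \<longleftrightarrow> c = Red"
  using assms entry_on_axis[of u v] diagonal_zero[of u]
  by (cases c) (auto simp: drift_edge_iff[OF B(2)] split: if_splits)

end

end

end

locale control_graph = lie_algebra L for L :: "'n::finite cmat set" +
  fixes C :: "'n edge set"
  assumes blue_edge: "({u, v}, Blue) \<in> C \<Longrightarrow> u \<noteq> v \<and> skew_unit 1 u v \<in> L"
    and red_edge: "({u, v}, Red) \<in> C \<Longrightarrow> u \<noteq> v \<and> skew_unit \<i> u v \<in> L"
    and green_edge: "({u, v}, Green) \<in> C \<Longrightarrow> u = v \<and> (\<exists>w. w \<noteq> u \<and> Dmat u w \<in> L)"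
begin

lemma linked_if_edge: "({u, v}, c) \<in> C \<Longrightarrow> u \<noteq> v \<Longrightarrow> linked u v"
  using blue_edge red_edge green_edge by (cases c) (auto simp: linked_def)

lemma linked_if_path:
  assumes "(u, v) \<in> (adj_rel E)\<^sup>*" and "\<And>u v. (u, v) \<in> adj_rel E \<Longrightarrow> u \<noteq> v \<Longrightarrow> linked u v"
  shows "u = v \<or> linked u v"
  using assms(1)
proof induction
  case (step v w)
  then show ?case using assms(2)[of v w] linked_trans[of u v w] by blast
qed simp

lemma linked_if_control_path: "(u, v) \<in> (adj_rel C)\<^sup>* \<Longrightarrow> u \<noteq> v \<Longrightarrow> linked u v"
  using linked_if_path[of u v C] linked_if_edge by (auto simp: adj_rel_def)

context
  fixes B
  assumes B: "B \<in> L" "B \<in> su" and no_multi_edge: "\<not> has_multi_edge (drift_edges {B})"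
    and components: "\<forall>K\<in>components C. card K \<ge> 3"
    and connected: "graph_connected (drift_edges {B} \<union> C)"
begin

lemma linked_if_drift_edge:
  assumes "({u, v}, c) \<in> drift_edges {B}" "u \<noteq> v"
  shows "linked u v"
proof (cases "(u, v) \<in> (adj_rel C)\<^sup>*")
  case True
  then show ?thesis using assms(2) by (rule linked_if_control_path)
next
  case False
  obtain p q where pq: "distinct [u, p, q]" "(u, p) \<in> (adj_rel C)\<^sup>*" "(u, q) \<in> (adj_rel C)\<^sup>*"
    using components by (rule two_other_nodes_in_component)
  obtain p' q' where pq': "distinct [v, p', q']" "(v, p') \<in> (adj_rel C)\<^sup>*" "(v, q') \<in> (adj_rel C)\<^sup>*"
    using components by (rule two_other_nodes_in_component)
  have "x \<noteq> y" if "(u, x) \<in> (adj_rel C)\<^sup>*" "(v, y) \<in> (adj_rel C)\<^sup>*" for x y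
    using that False by (metis rtrancl_trans sym_adj_rel sym_rtrancl symD)
  then have "distinct [u, p, q, v, p', q']"
    using pq pq' by (simp; metis rtrancl.rtrancl_refl)
  moreover have "B $ u $ v \<noteq> 0"
    using assms by (cases c) (auto simp: drift_edge_iff[OF B(2)])
  ultimately show ?thesis
    using pq pq' B linked_if_control_path
      Re_or_Im_zero_if_no_multi_edge[OF B(2) no_multi_edge assms(2)]
    by (intro linked_if_isolated_entry[of u p q v p' q' B]) (auto simp: in_su_iff)
qed

lemma all_linked:
  assumes "u \<noteq> v" shows "linked u v"
proof -
  have "linked u v" if "(u, v) \<in> adj_rel (drift_edges {B} \<union> C)" "u \<noteq> v" for u v
    using that linked_if_drift_edge linked_if_edge by (auto simp: adj_rel_def)
  then show ?thesis
    using linked_if_path[of u v "drift_edges {B} \<union> C"] connected assms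
    by (auto simp: graph_connected_def)
qed

lemma no_self_loop_if_not_full:
  assumes not_full: "\<And>a b. \<not> full a b"
  shows "({u}, c) \<notin> drift_edges {B} \<union> C"
proof
  assume "({u}, c) \<in> drift_edges {B} \<union> C"
  then consider "({u, u}, c) \<in> drift_edges {B}" | "({u, u}, c) \<in> C" by auto
  then show False
  proof cases
    case 1
    then show False
      using diagonal_zero[OF all_linked not_full B, of u] drift_edge_iff[OF B(2), of u u]
      by (cases c) auto
  next
    case 2
    then obtain w where "w \<noteq> u" "Dmat u w \<in> L"
      using blue_edge[of u u] red_edge[of u u] green_edge[of u u] by (cases c) auto
    then show False using full_if_Dmat[of u w] all_linked[of u w] not_full by blast
  qed
qed

lemma red_iff_if_not_full:
  assumes not_full: "\<And>a b. \<not> full a b" and edge: "({u, v}, c) \<in> drift_edges {B} \<union> C"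
  shows "red u v \<longleftrightarrow> c = Red"
proof (cases "({u, v}, c) \<in> C")
  case True
  then show ?thesis
    using blue_edge red_edge green_edge[of u v] no_self_loop_if_not_full[OF not_full, of u c]
      skew_unit_one_iff_not_red[OF all_linked not_full, of u v]
    by (cases c) (auto simp: red_def)
next
  case False
  then show ?thesis using drift_edge_red_iff[OF all_linked not_full B] edge by blast
qed

theorem su_subset_if_loop_or_odd_cycle:
  assumes "has_self_loop (drift_edges {B} \<union> C) \<or>
    (\<exists>w. is_cycle (drift_edges {B} \<union> C) w \<and> odd (num_red w))" (is "has_self_loop ?E \<or> _")
  shows "su \<subseteq> L"
proof -
  have "\<exists>a b. full a b"
  proof (rule ccontr)
    assume "\<nexists>a b. full a b"
    then have not_full: "\<And>a b. \<not> full a b" by blast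
    have "even (num_red w)" if "is_cycle ?E w" for w
      using that walk_parity[of red ?E w, OF red_cocycle[OF all_linked not_full]
          red_iff_if_not_full[OF not_full]]
      by (simp add: is_cycle_def red_def)
    moreover have "\<not> has_self_loop ?E"
      using no_self_loop_if_not_full[OF not_full] by (simp add: has_self_loop_def)
    ultimately show False using assms by blast
  qed
  then show ?thesis using su_subset_if_full all_linked by blast
qed

end

end

lemma control_graph_contr_edges:
  fixes S1 S2 S3 L :: "'n::{finite,linorder} cmat set"
  assumes "lie_algebra L" "S1 \<union> S2 \<union> S3 \<subseteq> L"
  shows "control_graph L (contr_edges S1 S2 S3)"
proof -
  interpret lie_algebra L by fact
  show ?thesis
  proof
    fix u v :: 'n
    assume "({u, v}, Blue) \<in> contr_edges S1 S2 S3"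
    then obtain i j where ij: "{u, v} = {i, j}" "i < j" "Bmat i j \<in> L"
      using assms(2) unfolding contr_edges_def by auto
    then have "skew_unit 1 i j \<in> L" "skew_unit 1 j i \<in> L"
      using Bmat_eq_skew_unit[of i j] skew_unit_swap_iff[of i j 1] by auto
    then show "u \<noteq> v \<and> skew_unit 1 u v \<in> L" using ij by (auto simp: doubleton_eq_iff)
  next
    fix u v :: 'n
    assume "({u, v}, Red) \<in> contr_edges S1 S2 S3"
    then obtain i j where ij: "{u, v} = {i, j}" "i < j" "Cmat i j \<in> L"
      using assms(2) unfolding contr_edges_def by auto
    then have "skew_unit \<i> i j \<in> L" "skew_unit \<i> j i \<in> L"
      using Cmat_eq_skew_unit[of i j] skew_unit_swap_iff[of i j \<i>]
      by (auto simp: skew_unit_minus_iff)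
    then show "u \<noteq> v \<and> skew_unit \<i> u v \<in> L" using ij by (auto simp: doubleton_eq_iff)
  next
    fix u v :: 'n
    assume "({u, v}, Green) \<in> contr_edges S1 S2 S3"
    then obtain i j where ij: "{u, v} = {i} \<or> {u, v} = {j}" "i < j" "Dmat i j \<in> S3"
      unfolding contr_edges_def by blast
    then have "Dmat i j \<in> L" using assms(2) by blast
    moreover from this have "Dmat j i \<in> L"
      using subspace_neg[OF subspace] by (simp add: Dmat_swap[of j i])
    ultimately show "u = v \<and> (\<exists>w. w \<noteq> u \<and> Dmat u w \<in> L)" using ij by auto
  qed
qed

section \<open>Closed submonoids of the special unitary group\<close>

lemma has_vector_derivative_sequence:
  fixes f :: "real \<Rightarrow> 'a::real_normed_vector"
  assumes "(f has_vector_derivative D) (at 0)"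
  shows "(\<lambda>k. real (Suc k) *\<^sub>R (f (1 / real (Suc k)) - f 0)) \<longlonglongrightarrow> D"
proof -
  have lim: "((\<lambda>h. norm (f h - f 0 - h *\<^sub>R D) / norm h) \<longlongrightarrow> 0) (at 0)"
    using assms unfolding has_vector_derivative_def has_derivative_at by simp
  have "filterlim (\<lambda>k. 1 / real (Suc k)) (at 0) sequentially"
    unfolding filterlim_at using LIMSEQ_inverse_real_of_nat by (simp add: inverse_eq_divide)
  from filterlim_compose[OF lim this]
  have "(\<lambda>k. norm (real (Suc k) *\<^sub>R (f (1 / real (Suc k)) - f 0) - D)) \<longlonglongrightarrow> 0"
  proof (rule Lim_transform_eventually, intro always_eventually allI)
    fix k
    let ?n = "real (Suc k)"
    have "?n *\<^sub>R (f (1 / ?n) - f 0) - D = ?n *\<^sub>R (f (1 / ?n) - f 0 - (1 / ?n) *\<^sub>R D)"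
      by (simp add: scaleR_diff_right)
    then show "norm (f (1 / ?n) - f 0 - (1 / ?n) *\<^sub>R D) / norm (1 / ?n)
        = norm (?n *\<^sub>R (f (1 / ?n) - f 0) - D)"
      by (simp add: mult.commute)
  qed
  then show ?thesis by (simp add: tendsto_norm_zero_iff LIM_zero_iff)
qed

lemma commutator_in_subspace:
  fixes V :: "'n::finite cmat set"
  assumes V: "subspace V" and conj: "\<And>t. mexp (t *\<^sub>R X) ** Y ** mexp (t *\<^sub>R (- X)) \<in> V"
  shows "commutator X Y \<in> V"
proof -
  define f where "f t = mexp (t *\<^sub>R X) ** Y ** mexp (t *\<^sub>R (- X))" for t
  have "(f has_vector_derivative mexp (0 *\<^sub>R X) ** Y ** (- X ** mexp (0 *\<^sub>R (- X)))
      + X ** mexp (0 *\<^sub>R X) ** Y ** mexp (0 *\<^sub>R (- X))) (at 0)"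
    unfolding f_def
    by (intro matmul.has_vector_derivative mexp_has_vector_derivative
        bounded_linear.has_vector_derivative[OF matmul.bounded_linear_left])
  then have "(f has_vector_derivative commutator X Y) (at 0)"
    by (simp add: matmul.minus_right)
  then have "(\<lambda>k. real (Suc k) *\<^sub>R (f (1 / real (Suc k)) - f 0)) \<longlonglongrightarrow> commutator X Y"
    by (rule has_vector_derivative_sequence)
  moreover have "real (Suc k) *\<^sub>R (f (1 / real (Suc k)) - f 0) \<in> V" for k
    using conj unfolding f_def by (intro subspace_scale[OF V] subspace_diff[OF V])
  ultimately show ?thesis
    using closed_sequentially[OF closed_subspace[OF V],
        of "\<lambda>k. real (Suc k) *\<^sub>R (f (1 / real (Suc k)) - f 0)"] by blast
qed

primrec mpow :: "'n::finite cmat \<Rightarrow> nat \<Rightarrow> 'n cmat" where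
  "mpow A 0 = mat 1"
| "mpow A (Suc n) = A ** mpow A n"

lemma mpow_add: "mpow A (m + n) = mpow A m ** mpow A n"
  by (induction m) (simp_all add: matrix_mul_assoc)

lemma mpow_mexp: "mpow (mexp A) n = mexp (real n *\<^sub>R A)"
proof (induction n)
  case (Suc n)
  have "mexp (A + real n *\<^sub>R A) = mexp A ** mexp (real n *\<^sub>R A)"
    by (rule mexp_add_commuting) (simp add: matmul.scaleR_left matmul.scaleR_right)
  then show ?case using Suc by (simp add: algebra_simps)
qed simp

lemma mpow_SU: "A \<in> SU \<Longrightarrow> mpow A n \<in> SU"
  by (induction n) (simp_all add: SU_mult)

lemma norm_mpow_diff:
  assumes "A \<in> SU" "B \<in> SU"
  shows "norm (mpow A n - mpow B n) \<le> real n * norm (A - B)"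
proof (induction n)
  case (Suc n)
  have "mpow A (Suc n) - mpow B (Suc n) = A ** (mpow A n - mpow B n) + (A - B) ** mpow B n"
    by (simp add: matmul.diff_left matmul.diff_right)
  also have "norm \<dots> \<le> norm (A ** (mpow A n - mpow B n)) + norm ((A - B) ** mpow B n)"
    by (rule norm_triangle_ineq)
  also have "\<dots> = norm (mpow A n - mpow B n) + norm (A - B)"
    by (simp add: norm_SU_mult_left[OF assms(1)] norm_SU_mult_right[OF mpow_SU[OF assms(2)]])
  finally show ?case using Suc by (simp add: algebra_simps)
qed simp

definition coord_stabilizer :: "'n set \<Rightarrow> 'n::finite cmat set" where
  "coord_stabilizer J = {U \<in> SU. U ** coord_proj J = coord_proj J}"

lemma coord_stabilizer_mult:
  "U \<in> coord_stabilizer J \<Longrightarrow> V \<in> coord_stabilizer J \<Longrightarrow> U ** V \<in> coord_stabilizer J"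
  by (simp add: coord_stabilizer_def SU_mult flip: matrix_mul_assoc)

lemma coord_stabilizer_entry:
  assumes "U \<in> coord_stabilizer J"
  shows "j \<in> J \<Longrightarrow> U $ k $ j = (if k = j then 1 else 0)"
    and "j \<in> J \<Longrightarrow> U $ j $ k = (if k = j then 1 else 0)"
proof -
  have U: "U \<in> SU" "U ** coord_proj J = coord_proj J"
    using assms by (auto simp: coord_stabilizer_def)
  then have "adjoint_mat U ** coord_proj J = adjoint_mat U ** U ** coord_proj J"
    by (simp flip: matrix_mul_assoc)
  then have "adjoint_mat (adjoint_mat U ** coord_proj J) = coord_proj J"
    by (simp add: SU_adjoint_left[OF U(1)])
  then have row: "coord_proj J ** U = coord_proj J" by (simp add: adjoint_mat_mult)
  show "U $ k $ j = (if k = j then 1 else 0)" if "j \<in> J"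
    using arg_cong[OF U(2), of "\<lambda>X. X $ k $ j"] that
    by (simp add: mult_coord_proj_entry coord_proj_entry)
  show "U $ j $ k = (if k = j then 1 else 0)" if "j \<in> J"
    using arg_cong[OF row, of "\<lambda>X. X $ j $ k"] that
    by (auto simp: coord_proj_mult_entry coord_proj_entry)
qed

lemma coord_stabilizerI:
  assumes "U \<in> SU" "\<And>j k. j \<in> J \<Longrightarrow> U $ k $ j = (if k = j then 1 else 0)"
  shows "U \<in> coord_stabilizer J"
  using assms by (simp add: coord_stabilizer_def vec_eq_iff mult_coord_proj_entry coord_proj_entry)

lemma closed_coord_stabilizer: "closed (coord_stabilizer J :: 'n::finite cmat set)"
  unfolding coord_stabilizer_def
  by (intro closed_Collect_conj closed_Collect_eq matmul.continuous_on continuous_on_const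
      continuous_on_id)
    (simp add: closed_SU)

lemma coord_stabilizer_Compl_singleton: "coord_stabilizer (- {a}) = {mat 1}"
proof -
  have "U = mat 1" if U: "U \<in> coord_stabilizer (- {a})" for U
  proof -
    have off: "U $ k $ l = 0" if "k \<noteq> l" for k l
      using coord_stabilizer_entry[OF U, of k l] coord_stabilizer_entry[OF U, of l k] that by auto
    then have "det U = (\<Prod>k\<in>UNIV. U $ k $ k)" by (rule det_diagonal)
    also have "\<dots> = (\<Prod>k\<in>UNIV. if k = a then U $ a $ a else 1)"
      by (rule prod.cong) (use coord_stabilizer_entry(1)[OF U] in auto)
    finally have "U $ a $ a = 1" using U by (simp add: coord_stabilizer_def SU_def)
    then have "U $ k $ k = 1" for k
      using coord_stabilizer_entry(1)[OF U, of k k] by (cases "k = a") simp_all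
    then have "U $ k $ l = mat 1 $ k $ l" for k l
      using off[of k l] by (cases "k = l") (simp_all add: mat_def)
    then show ?thesis by (simp add: vec_eq_iff)
  qed
  moreover have "mat 1 \<in> coord_stabilizer (- {a})" by (simp add: coord_stabilizer_def)
  ultimately show ?thesis by blast
qed

lemma mexp_in_coord_stabilizer:
  assumes "Z \<in> su" "Z ** coord_proj J = 0"
  shows "mexp (t *\<^sub>R Z) \<in> coord_stabilizer J"
  unfolding coord_stabilizer_def
  using assms by (simp add: mexp_in_SU subspace_scale[OF subspace_su] mexp_mult_if_annihilates)

locale closed_SU_monoid =
  fixes H :: "'n::finite cmat set"
  assumes closed: "closed H" and subset_SU: "H \<subseteq> SU" and one: "mat 1 \<in> H"
    and mult: "X \<in> H \<Longrightarrow> Y \<in> H \<Longrightarrow> X ** Y \<in> H"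
begin

lemma compact: "compact H"
  using compact_Int_closed[OF compact_SU closed] subset_SU by (simp add: Int_absorb1)

lemma mpow_in: "g \<in> H \<Longrightarrow> mpow g n \<in> H"
  by (induction n) (simp_all add: one mult)

text \<open>By compactness some powers \<open>g\<^sup>m\<close> and \<open>g\<^sup>n\<close> with \<open>m < n\<close> are close to each other, and then
  \<open>g\<close> to the power \<open>n - m - 1\<close> is close to the inverse of \<open>g\<close>.\<close>

lemma adjoint_in:
  assumes g: "g \<in> H" shows "adjoint_mat g \<in> H"
proof -
  have gSU: "g \<in> SU" using g subset_SU by blast
  obtain L r where r: "strict_mono (r :: nat \<Rightarrow> nat)" "((\<lambda>n. mpow g n) \<circ> r) \<longlonglongrightarrow> L"
    using compact mpow_in[OF g] unfolding compact_def by metis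
  have "Cauchy ((\<lambda>n. mpow g n) \<circ> r)"
    using r(2) by (intro convergent_Cauchy) (auto simp: convergent_def)
  have "adjoint_mat g \<in> closure H"
    unfolding closure_approachable
  proof (intro allI impI)
    fix \<epsilon> :: real assume "\<epsilon> > 0"
    with \<open>Cauchy _\<close> obtain N where N: "\<And>m n. m \<ge> N \<Longrightarrow> n \<ge> N \<Longrightarrow> dist (mpow g (r m)) (mpow g (r n)) < \<epsilon>"
      unfolding Cauchy_def o_def by blast
    have "r N < r (Suc N)" using r(1) by (simp add: strict_mono_def)
    then obtain p where p: "r (Suc N) = r N + Suc p" using less_imp_Suc_add by auto
    have "mpow g (r (Suc N)) - mpow g (r N) = mpow g (r N) ** (g ** (mpow g p - adjoint_mat g))"
      unfolding p mpow_add by (simp add: matmul.diff_right SU_adjoint_right[OF gSU])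
    then have "norm (mpow g (r (Suc N)) - mpow g (r N)) = norm (mpow g p - adjoint_mat g)"
      by (simp add: norm_SU_mult_left gSU mpow_SU)
    then have "dist (mpow g p) (adjoint_mat g) < \<epsilon>"
      using N[of "Suc N" N] unfolding dist_norm by simp
    then show "\<exists>y\<in>H. dist y (adjoint_mat g) < \<epsilon>" using mpow_in[OF g] by blast
  qed
  then show ?thesis using closed by simp
qed

lemma mexp_limit_in:
  assumes g: "\<And>k. g k \<in> H" and Z: "Z \<in> su"
    and lim: "(\<lambda>k. real (Suc k) *\<^sub>R (g k - mat 1)) \<longlonglongrightarrow> Z"
  shows "mexp Z \<in> H"
proof -
  define E where "E k = mexp ((1 / real (Suc k)) *\<^sub>R Z)" for k
  have ESU: "E k \<in> SU" for k
    unfolding E_def by (intro mexp_in_SU subspace_scale[OF subspace_su] Z)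
  have "(\<lambda>k. real (Suc k) *\<^sub>R (E k - mexp (0 *\<^sub>R Z))) \<longlonglongrightarrow> Z ** mexp (0 *\<^sub>R Z)"
    unfolding E_def by (rule has_vector_derivative_sequence[OF mexp_has_vector_derivative])
  then have "(\<lambda>k. real (Suc k) *\<^sub>R (g k - mat 1) - real (Suc k) *\<^sub>R (E k - mat 1)) \<longlonglongrightarrow> Z - Z"
    using lim by (intro tendsto_diff) simp_all
  then have "(\<lambda>k. real (Suc k) *\<^sub>R (g k - E k)) \<longlonglongrightarrow> 0"
    by (simp flip: scaleR_diff_right)
  then have difference_null: "(\<lambda>k. norm (real (Suc k) *\<^sub>R (g k - E k))) \<longlonglongrightarrow> 0"
    by (rule tendsto_norm_zero)
  have power_close: "norm (mpow (g k) (Suc k) - mexp Z) \<le> norm (real (Suc k) *\<^sub>R (g k - E k))" for k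
  proof -
    have "mpow (E k) (Suc k) = mexp Z" unfolding E_def mpow_mexp by simp
    then show ?thesis
      using norm_mpow_diff[of "g k" "E k" "Suc k"] g subset_SU ESU by auto
  qed
  have "(\<lambda>k. mpow (g k) (Suc k) - mexp Z) \<longlonglongrightarrow> 0"
    by (rule Lim_null_comparison[OF always_eventually[OF allI[OF power_close]] difference_null])
  then have "(\<lambda>k. mpow (g k) (Suc k)) \<longlonglongrightarrow> mexp Z" by (rule LIM_zero_cancel)
  then show ?thesis
    using closed_sequentially[OF closed, of "\<lambda>k. mpow (g k) (Suc k)"] mpow_in[OF g] by blast
qed

definition tangent :: "'n cmat set" where
  "tangent = {Z \<in> su. \<forall>t. mexp (t *\<^sub>R Z) \<in> H}"

lemma mexp_in: "Z \<in> tangent \<Longrightarrow> mexp (t *\<^sub>R Z) \<in> H"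
  by (simp add: tangent_def)

lemma tangent_add:
  assumes X: "X \<in> tangent" and Y: "Y \<in> tangent"
  shows "X + Y \<in> tangent"
proof -
  have su: "X + Y \<in> su" using X Y by (auto simp: tangent_def intro: subspace_add[OF subspace_su])
  have "mexp (t *\<^sub>R (X + Y)) \<in> H" for t
  proof (rule mexp_limit_in)
    define f where "f s = mexp (s *\<^sub>R (t *\<^sub>R X)) ** mexp (s *\<^sub>R (t *\<^sub>R Y))" for s
    show "f (1 / real (Suc k)) \<in> H" for k
      unfolding f_def scaleR_scaleR by (intro mult mexp_in X Y)
    show "t *\<^sub>R (X + Y) \<in> su" by (rule subspace_scale[OF subspace_su su])
    have "(f has_vector_derivative (mexp (0 *\<^sub>R (t *\<^sub>R X)) ** (t *\<^sub>R Y ** mexp (0 *\<^sub>R (t *\<^sub>R Y)))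
        + t *\<^sub>R X ** mexp (0 *\<^sub>R (t *\<^sub>R X)) ** mexp (0 *\<^sub>R (t *\<^sub>R Y)))) (at 0)"
      unfolding f_def by (intro matmul.has_vector_derivative mexp_has_vector_derivative)
    then have "(f has_vector_derivative t *\<^sub>R (X + Y)) (at 0)"
      by (simp add: algebra_simps)
    from has_vector_derivative_sequence[OF this]
    show "(\<lambda>k. real (Suc k) *\<^sub>R (f (1 / real (Suc k)) - mat 1)) \<longlonglongrightarrow> t *\<^sub>R (X + Y)"
      by (simp add: f_def)
  qed
  then show ?thesis using su by (simp add: tangent_def)
qed

lemma subspace_tangent: "subspace tangent"
  unfolding subspace_def
  using subspace_0[OF subspace_su] subspace_scale[OF subspace_su] one tangent_add
  by (auto simp: tangent_def)

lemma tangent_conj: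
  assumes "U \<in> H" "X \<in> tangent"
  shows "U ** X ** adjoint_mat U \<in> tangent"
proof -
  have U: "U \<in> SU" using assms subset_SU by blast
  have "mexp (t *\<^sub>R (U ** X ** adjoint_mat U)) \<in> H" for t
    unfolding mexp_conj[OF SU_adjoint_left[OF U], symmetric]
    by (intro mult adjoint_in mexp_in assms)
  then show ?thesis using assms su_conj[OF U] by (simp add: tangent_def)
qed

lemma lie_algebra_tangent: "lie_algebra tangent"
proof
  show "subspace tangent" by (rule subspace_tangent)
next
  fix X Y assume X: "X \<in> tangent" and Y: "Y \<in> tangent"
  show "commutator X Y \<in> tangent"
  proof (rule commutator_in_subspace[OF subspace_tangent])
    fix t
    have "t *\<^sub>R X \<in> su" using X subspace_scale[OF subspace_su] by (auto simp: tangent_def)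
    then show "mexp (t *\<^sub>R X) ** Y ** mexp (t *\<^sub>R (- X)) \<in> tangent"
      using tangent_conj[OF mexp_in[OF X] Y] mexp_minus_su[of "t *\<^sub>R X"] by simp
  qed
qed

end

lemma eq_minus_one_if_Re_le:
  assumes "cmod z \<le> 1" "Re z \<le> - 1"
  shows "z = - 1"
proof -
  have "Re z = - 1" using assms abs_Re_le_cmod[of z] by linarith
  moreover have "(cmod z)\<^sup>2 \<le> 1" using assms(1) by (simp add: power_le_one)
  ultimately show ?thesis by (simp add: cmod_power2 complex_eq_iff)
qed

lemma mexp_mult_entry_has_vector_derivative:
  fixes Z V :: "'n::finite cmat"
  shows
  "((\<lambda>t. (mexp (t *\<^sub>R Z) ** V) $ i $ j) has_vector_derivative
      (Z ** mexp (t *\<^sub>R Z) ** V) $ i $ j) (at t)"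
proof -
  have "bounded_linear (\<lambda>X. (X ** V) $ i $ j)"
    by (rule bounded_linear_compose[OF bounded_linear_vec_nth
          bounded_linear_compose[OF bounded_linear_vec_nth matmul.bounded_linear_left]])
  then show ?thesis
    by (rule bounded_linear.has_vector_derivative[OF _ mexp_has_vector_derivative])
qed

context closed_SU_monoid
begin

definition maximal_entry :: "'n set \<Rightarrow> 'n \<Rightarrow> 'n cmat \<Rightarrow> bool" where
  "maximal_entry J a V \<longleftrightarrow> V \<in> coord_stabilizer J \<and>
    (\<forall>g\<in>H \<inter> coord_stabilizer J. Re ((g ** V) $ a $ a) \<le> Re (V $ a $ a))"

lemma maximal_entry_exists:
  assumes "U \<in> coord_stabilizer J"
  shows "\<exists>h\<in>H. maximal_entry J a (h ** U)"
proof -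
  have "compact (H \<inter> coord_stabilizer J)"
    by (intro compact_Int_closed compact closed_coord_stabilizer)
  moreover have "mat 1 \<in> H \<inter> coord_stabilizer J"
    by (simp add: one coord_stabilizer_def)
  moreover have "continuous_on (H \<inter> coord_stabilizer J) (\<lambda>h. Re ((h ** U) $ a $ a))"
    by (intro continuous_on_Re continuous_on_component matmul.continuous_on continuous_on_const
        continuous_on_id)
  ultimately obtain h where h: "h \<in> H \<inter> coord_stabilizer J"
    "\<forall>g\<in>H \<inter> coord_stabilizer J. Re ((g ** U) $ a $ a) \<le> Re ((h ** U) $ a $ a)"
    using continuous_attains_sup[of "H \<inter> coord_stabilizer J"] by blast
  have "Re ((g ** (h ** U)) $ a $ a) \<le> Re ((h ** U) $ a $ a)" if "g \<in> H \<inter> coord_stabilizer J" for g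
    using h that mult[of g h] coord_stabilizer_mult[of g J h] by (simp add: matrix_mul_assoc)
  then show ?thesis
    using h(1) assms by (intro bexI[of _ h]) (auto simp: maximal_entry_def coord_stabilizer_mult)
qed

context
  assumes su_subset_tangent: "su \<subseteq> tangent"
begin

lemma mexp_in_stabilizer:
  "Z \<in> su \<Longrightarrow> Z ** coord_proj J = 0 \<Longrightarrow> mexp (t *\<^sub>R Z) \<in> H \<inter> coord_stabilizer J"
  using su_subset_tangent by (auto intro: mexp_in mexp_in_coord_stabilizer)

lemma maximal_entry_critical:
  assumes "maximal_entry J a V" "Z \<in> su" "Z ** coord_proj J = 0"
  shows "Re ((Z ** V) $ a $ a) = 0"
proof (rule DERIV_local_max[where d = 1])
  show "DERIV (\<lambda>t. Re ((mexp (t *\<^sub>R Z) ** V) $ a $ a)) 0 :> Re ((Z ** V) $ a $ a)"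
    unfolding has_real_derivative_iff_has_vector_derivative
    using bounded_linear.has_vector_derivative[OF bounded_linear_Re
        mexp_mult_entry_has_vector_derivative[of Z V a a 0]] by simp
  show "\<forall>t. \<bar>0 - t\<bar> < 1 \<longrightarrow> Re ((mexp (t *\<^sub>R Z) ** V) $ a $ a) \<le> Re ((mexp (0 *\<^sub>R Z) ** V) $ a $ a)"
    using assms(1) mexp_in_stabilizer[OF assms(2,3)] by (simp add: maximal_entry_def)
qed simp

text \<open>Since no entry of a unitary matrix has real part below \<open>- 1\<close>, a maximal entry \<open>- 1\<close> would be
  constant along the rotations generated by \<open>Dmat a c\<close>, which multiply it by phases.\<close>

lemma maximal_entry_neq_minus_one:
  assumes max: "maximal_entry J a V" and ac: "a \<notin> J" "c \<notin> J" "a \<noteq> c"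
  shows "V $ a $ a \<noteq> - 1"
proof
  assume minus: "V $ a $ a = - 1"
  have "(mexp (t *\<^sub>R Dmat a c) ** V) $ a $ a = - 1" for t
  proof -
    have E: "mexp (t *\<^sub>R Dmat a c) \<in> H \<inter> coord_stabilizer J"
      by (rule mexp_in_stabilizer[OF Dmat_in_su Dmat_mult_coord_proj[OF ac(1,2)]])
    then have "mexp (t *\<^sub>R Dmat a c) ** V \<in> SU"
      using max subset_SU SU_mult by (auto simp: maximal_entry_def coord_stabilizer_def)
    then have "cmod ((mexp (t *\<^sub>R Dmat a c) ** V) $ a $ a) \<le> 1" by (rule cmod_SU_entry_le_one)
    moreover have "Re ((mexp (t *\<^sub>R Dmat a c) ** V) $ a $ a) \<le> - 1"
      using max E minus by (auto simp: maximal_entry_def)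
    ultimately show ?thesis by (rule eq_minus_one_if_Re_le)
  qed
  then have "((\<lambda>t. (mexp (t *\<^sub>R Dmat a c) ** V) $ a $ a) has_vector_derivative 0) (at 0)"
    by simp
  from vector_derivative_unique_at[OF this mexp_mult_entry_has_vector_derivative]
  show False using minus ac(3) by (simp add: Dmat_mult_entry)
qed

lemma maximal_entry_in_coord_stabilizer_insert:
  assumes max: "maximal_entry J a V" and ac: "a \<notin> J" "c \<notin> J" "a \<noteq> c"
  shows "V \<in> coord_stabilizer (insert a J)"
proof -
  have V: "V \<in> coord_stabilizer J" "V \<in> SU"
    using max by (auto simp: maximal_entry_def coord_stabilizer_def)
  have off: "V $ d $ a = 0" if "d \<noteq> a" for d
  proof (cases "d \<in> J")
    case True
    then show ?thesis using coord_stabilizer_entry(2)[OF V(1), of d a] that by simp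
  next
    case False
    from maximal_entry_critical[OF max skew_unit_in_su skew_unit_mult_coord_proj[OF ac(1) False]] that
    have "Re ((skew_unit (cnj (V $ d $ a)) a d ** V) $ a $ a) = 0" by simp
    then show ?thesis
      using that by (simp add: skew_unit_mult_entry complex_eq_iff sum_squares_eq_zero_iff)
  qed
  have "Im (V $ a $ a) = 0"
    using maximal_entry_critical[OF max Dmat_in_su Dmat_mult_coord_proj[OF ac(1,2)]] ac(3)
    by (simp add: Dmat_mult_entry)
  moreover have "(\<Sum>k\<in>UNIV. (cmod (V $ k $ a))\<^sup>2) = (cmod (V $ a $ a))\<^sup>2"
    by (rule sum.remove[of UNIV a, THEN trans]) (simp_all add: off)
  then have "(cmod (V $ a $ a))\<^sup>2 = 1" using SU_column_norm[OF V(2)] by simp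
  ultimately have "V $ a $ a = 1 \<or> V $ a $ a = - 1"
    by (simp add: cmod_power2 complex_eq_iff power2_eq_1_iff)
  then have "V $ a $ a = 1" using maximal_entry_neq_minus_one[OF assms] by blast
  then show ?thesis
    using off coord_stabilizer_entry(1)[OF V(1)] by (intro coord_stabilizerI V) auto
qed

lemma coord_stabilizer_Compl_subset: "finite K \<Longrightarrow> coord_stabilizer (- K) \<subseteq> H"
proof (induction K rule: finite_induct)
  case empty
  then show ?case using one by (auto simp: coord_stabilizer_def)
next
  case (insert a K)
  show ?case
  proof (cases "K = {}")
    case True
    then show ?thesis using one by (simp add: coord_stabilizer_Compl_singleton)
  next
    case False
    then obtain c where c: "c \<in> K" by blast
    show ?thesis
    proof
      fix U assume U: "U \<in> coord_stabilizer (- insert a K)"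
      obtain h where h: "h \<in> H" and max: "maximal_entry (- insert a K) a (h ** U)"
        using maximal_entry_exists[OF U] by blast
      have "insert a (- insert a K) = - K" using insert.hyps by auto
      then have "h ** U \<in> H"
        using maximal_entry_in_coord_stabilizer_insert[OF max, of c] c insert by auto
      then have "adjoint_mat h ** (h ** U) \<in> H" by (rule mult[OF adjoint_in[OF h]])
      moreover have "h \<in> SU" using h subset_SU by blast
      ultimately show "U \<in> H" by (simp add: matrix_mul_assoc SU_adjoint_left)
    qed
  qed
qed

theorem SU_subset_if_su_subset_tangent: "SU \<subseteq> H"
  using coord_stabilizer_Compl_subset[of UNIV] by (simp add: coord_stabilizer_def)

end

end

section \<open>A complement of the Lie algebra of the special unitary group\<close>

definition hermitian_part :: "'n::finite cmat \<Rightarrow> 'n cmat" where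
  "hermitian_part A = (1/2) *\<^sub>R (A + adjoint_mat A)"

definition mean_phase :: "'n::finite cmat \<Rightarrow> real" where
  "mean_phase A = Im (trace A) / real CARD('n)"

definition su_part :: "'n::finite cmat \<Rightarrow> 'n cmat" where
  "su_part A = A - hermitian_part A - mat (\<i> * of_real (mean_phase A))"

lemma bounded_linear_hermitian_part: "bounded_linear (hermitian_part :: 'n::finite cmat \<Rightarrow> _)"
  unfolding linear_conv_bounded_linear[symmetric]
  by (rule linearI)
    (simp_all add: hermitian_part_def adjoint_mat_add adjoint_mat_scaleR scaleR_add_right)

lemma bounded_linear_mean_phase: "bounded_linear (mean_phase :: 'n::finite cmat \<Rightarrow> _)"
  unfolding linear_conv_bounded_linear[symmetric]
  by (rule linearI) (simp_all add: mean_phase_def trace_add trace_scaleR add_divide_distrib)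

lemma bounded_linear_mat: "bounded_linear (mat :: complex \<Rightarrow> 'n::finite cmat)"
  unfolding linear_conv_bounded_linear[symmetric]
  by (rule linearI) (simp_all add: vec_eq_iff mat_def)

lemma bounded_linear_su_part: "bounded_linear (su_part :: 'n::finite cmat \<Rightarrow> _)"
  unfolding su_part_def
  by (intro bounded_linear_sub bounded_linear_ident bounded_linear_hermitian_part
      bounded_linear_compose[OF bounded_linear_mat]
      bounded_linear_compose[OF bounded_linear_mult_right]
      bounded_linear_compose[OF bounded_linear_of_real] bounded_linear_mean_phase)

lemma adjoint_hermitian_part [simp]: "adjoint_mat (hermitian_part A) = hermitian_part A"
  by (simp add: hermitian_part_def adjoint_mat_scaleR adjoint_mat_add add.commute)

lemma su_part_in_su: "su_part A \<in> su"
proof -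
  have "A - hermitian_part A = (1/2) *\<^sub>R (A - adjoint_mat A)"
    by (simp add: hermitian_part_def vec_eq_iff scaleR_conv_of_real[where 'a=complex] field_simps)
  then have su_part: "su_part A = (1/2) *\<^sub>R (A - adjoint_mat A) - mat (\<i> * of_real (mean_phase A))"
    by (simp add: su_part_def)
  have "skew_hermitian (su_part A)"
    unfolding su_part adjoint_mat_diff adjoint_mat_scaleR
    by (simp add: vec_eq_iff mat_def algebra_simps)
  moreover have "trace (su_part A) = 0"
    unfolding su_part trace_sub trace_scaleR trace_adjoint_mat
    by (simp add: trace_mat mean_phase_def complex_eq_iff)
  ultimately show ?thesis by (simp add: in_su_iff)
qed

lemma SU_transversal:
  "\<exists>\<delta>>0. \<forall>(H :: 'n::finite cmat) \<theta>. adjoint_mat H = H \<longrightarrow> norm H < \<delta> \<longrightarrow> \<bar>\<theta>\<bar> < \<delta> \<longrightarrow>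
    mat (cis \<theta>) ** (mat 1 + H) \<in> SU \<longrightarrow> H = 0 \<and> \<theta> = 0"
proof -
  obtain K where K: "K > 0" "\<And>(A::'n cmat) (B::'n cmat). norm (A ** B) \<le> norm A * norm B * K"
    using matmul.pos_bounded by blast
  define \<delta> where "\<delta> = min (1 / K) (1 / real CARD('n))"
  have "H = 0 \<and> \<theta> = 0" if H: "adjoint_mat H = H" "norm H < \<delta>" and \<theta>: "\<bar>\<theta>\<bar> < \<delta>"
    and SU: "mat (cis \<theta>) ** (mat 1 + H) \<in> SU" for H :: "'n cmat" and \<theta>
  proof -
    have "mat 1 = (mat 1 + H) ** (mat (cnj (cis \<theta>)) ** mat (cis \<theta>)) ** (mat 1 + H)"
      using SU_adjoint_left[OF SU]
      by (simp add: adjoint_mat_mult adjoint_mat_add H(1) matrix_mul_assoc)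
    also have "\<dots> = (mat 1 + H) ** (mat 1 + H)" by (simp add: mat_mult_mat cis_cnj cis_mult)
    finally have "2 *\<^sub>R H = - (H ** H)"
      by (simp add: matmul.add_left matmul.add_right scaleR_2 eq_neg_iff_add_eq_0 add.assoc)
    then have "2 * norm H = norm (H ** H)" by (metis abs_numeral norm_minus_cancel norm_scaleR)
    then have "2 * norm H \<le> norm H * (norm H * K)" using K(2)[of H H] by (simp add: mult.assoc)
    moreover have "norm H * K \<le> 1" using H(2) K(1) by (simp add: \<delta>_def field_simps)
    then have "norm H * (norm H * K) \<le> norm H * 1" by (intro mult_left_mono) simp_all
    ultimately have "norm H \<le> 0" by linarith
    then have "H = 0" by simp
    moreover have "cis \<theta> ^ CARD('n) = 1"
      using SU \<open>H = 0\<close> by (simp add: SU_def det_mat)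
    then have "cis (real CARD('n) * \<theta>) = 1" by (simp only: Complex.DeMoivre)
    then have "sin (real CARD('n) * \<theta>) = 0" by (simp add: complex_eq_iff)
    moreover have "\<bar>real CARD('n) * \<theta>\<bar> < 1" using \<theta> by (simp add: \<delta>_def abs_mult field_simps)
    ultimately show ?thesis using sin_eq_0_pi[of "real CARD('n) * \<theta>"] pi_gt3 by auto
  qed
  moreover have "\<delta> > 0" using K(1) by (simp add: \<delta>_def)
  ultimately show ?thesis by blast
qed

text \<open>To first order \<open>thicken h\<close> adds to \<open>h\<close> the directions that \<open>su(n)\<close> lacks in the space of all
  matrices.\<close>

definition thicken :: "('n::finite cmat \<Rightarrow> 'n cmat) \<Rightarrow> 'n cmat \<Rightarrow> 'n cmat" where
  "thicken h Y = mat (cis (mean_phase Y)) ** (mat 1 + hermitian_part Y) ** h Y"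

lemma continuous_on_thicken: "continuous_on S h \<Longrightarrow> continuous_on S (thicken h)"
  unfolding thicken_def
  by (intro matmul.continuous_on bounded_linear.continuous_on[OF bounded_linear_mat] continuous_on_cis
      continuous_on_add continuous_on_const linear_continuous_on[OF bounded_linear_hermitian_part]
      linear_continuous_on[OF bounded_linear_mean_phase])

lemma mean_phase_zero [simp]: "mean_phase 0 = 0"
  and hermitian_part_zero [simp]: "hermitian_part 0 = 0"
  using bounded_linear.linear[THEN linear_0] bounded_linear_mean_phase bounded_linear_hermitian_part
  by blast+

lemma thicken_has_derivative:
  fixes h :: "'n::finite cmat \<Rightarrow> 'n cmat"
  assumes "(h has_derivative (\<lambda>Y. su_part Y ** h 0)) (at 0)"
  shows "(thicken h has_derivative (\<lambda>Y. Y ** h 0)) (at 0)"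
proof -
  have phase: "((\<lambda>Y::'n cmat. mat (cis (mean_phase Y)) :: 'n cmat) has_derivative
      (\<lambda>Y. mat (mean_phase Y *\<^sub>R (\<i> * cis (mean_phase (0 :: 'n cmat)))))) (at 0)"
    by (intro bounded_linear.has_derivative[OF bounded_linear_mat] has_derivative_cis
        bounded_linear_imp_has_derivative bounded_linear_mean_phase)
  have "((\<lambda>Y::'n cmat. mat 1 + hermitian_part Y) has_derivative (\<lambda>Y. 0 + hermitian_part Y)) (at 0)"
    by (intro has_derivative_add has_derivative_const bounded_linear_imp_has_derivative
        bounded_linear_hermitian_part)
  from matmul.FDERIV[OF phase this]
  have "((\<lambda>Y::'n cmat. mat (cis (mean_phase Y)) ** (mat 1 + hermitian_part Y)) has_derivative
      (\<lambda>Y. hermitian_part Y + mat (\<i> * of_real (mean_phase Y)))) (at 0)"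
    by (simp add: scaleR_conv_of_real[where 'a=complex] mult.commute)
  from matmul.FDERIV[OF this assms]
  have "(thicken h has_derivative (\<lambda>Y. (mat 1 + hermitian_part 0) ** (su_part Y ** h 0)
      + (hermitian_part Y + mat (\<i> * of_real (mean_phase Y))) ** h 0)) (at 0)"
    by (simp add: thicken_def[abs_def])
  moreover have "su_part Y ** h 0 + (hermitian_part Y + mat (\<i> * of_real (mean_phase Y))) ** h 0
      = Y ** h 0" for Y :: "'n cmat"
    by (simp add: su_part_def flip: matmul.add_left)
  ultimately show ?thesis by simp
qed

lemma thicken_covers_ball:
  assumes h: "continuous_on UNIV h" "(h has_derivative (\<lambda>Y. su_part Y ** h 0)) (at 0)" "h 0 \<in> SU"
    and "\<delta> > 0"
  shows "\<exists>\<epsilon>>0. ball (h 0) \<epsilon> \<subseteq> thicken h ` {Y. norm (hermitian_part Y) < \<delta> \<and> \<bar>mean_phase Y\<bar> < \<delta>}"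
    (is "\<exists>\<epsilon>>0. _ \<subseteq> _ ` ?N")
proof -
  have "thicken h 0 \<in> interior (thicken h ` ?N)"
  proof (rule sussmann_open_mapping[of UNIV _ _ "\<lambda>Y. Y ** h 0" "\<lambda>Y. Y ** adjoint_mat (h 0)"])
    show "continuous_on UNIV (thicken h)" using h(1) by (rule continuous_on_thicken)
    show "(thicken h has_derivative (\<lambda>Y. Y ** h 0)) (at 0)"
      using h(2) by (rule thicken_has_derivative)
    show "(\<lambda>Y. Y ** h 0) \<circ> (\<lambda>Y. Y ** adjoint_mat (h 0)) = id"
      by (simp add: fun_eq_iff matrix_mul_assoc[symmetric] SU_adjoint_left[OF h(3)])
    have "open ?N"
      by (intro open_Collect_conj open_Collect_less continuous_intros
          linear_continuous_on[OF bounded_linear_hermitian_part]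
          linear_continuous_on[OF bounded_linear_mean_phase])
    then show "0 \<in> interior ?N" using \<open>\<delta> > 0\<close> by (simp add: interior_open)
  qed (auto intro: matmul.bounded_linear_left)
  then show ?thesis by (simp add: thicken_def mem_interior)
qed

lemma SU_ball_subset_range:
  assumes h: "continuous_on UNIV h" "(h has_derivative (\<lambda>Y. su_part Y ** h 0)) (at 0)"
    and h_SU: "range h \<subseteq> SU"
  shows "\<exists>\<epsilon>>0. SU \<inter> ball (h 0) \<epsilon> \<subseteq> range h"
proof -
  obtain \<delta> where \<delta>: "\<delta> > 0" "\<And>(H :: 'a cmat) \<theta>. adjoint_mat H = H \<Longrightarrow> norm H < \<delta> \<Longrightarrow> \<bar>\<theta>\<bar> < \<delta> \<Longrightarrow>
      mat (cis \<theta>) ** (mat 1 + H) \<in> SU \<Longrightarrow> H = 0 \<and> \<theta> = 0"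
    using SU_transversal[where 'n = 'a] by blast
  have "h 0 \<in> SU" using h_SU by blast
  then obtain \<epsilon> where \<epsilon>: "\<epsilon> > 0"
    "ball (h 0) \<epsilon> \<subseteq> thicken h ` {Y. norm (hermitian_part Y) < \<delta> \<and> \<bar>mean_phase Y\<bar> < \<delta>}"
    using thicken_covers_ball[OF h _ \<delta>(1)] by blast
  have "g \<in> range h" if g: "g \<in> SU" "g \<in> ball (h 0) \<epsilon>" for g
  proof -
    obtain Y where Y: "norm (hermitian_part Y) < \<delta>" "\<bar>mean_phase Y\<bar> < \<delta>" "g = thicken h Y"
      using \<epsilon>(2) g(2) by blast
    have hY: "h Y \<in> SU" using h_SU by blast
    have "g ** adjoint_mat (h Y) = mat (cis (mean_phase Y)) ** (mat 1 + hermitian_part Y)"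
      unfolding Y(3) thicken_def by (simp add: SU_adjoint_right[OF hY] flip: matrix_mul_assoc)
    moreover have "g ** adjoint_mat (h Y) \<in> SU" by (intro SU_mult SU_adjoint hY g(1))
    ultimately have "hermitian_part Y = 0 \<and> mean_phase Y = 0"
      using Y(1,2) by (intro \<delta>(2)) auto
    then show ?thesis by (simp add: Y(3) thicken_def)
  qed
  then show ?thesis using \<epsilon>(1) by blast
qed

section \<open>Semigroups generated by exponentials\<close>

inductive_set exp_semigroup :: "'n::finite cmat set \<Rightarrow> 'n cmat set" for F where
  one: "mat 1 \<in> exp_semigroup F"
| step: "Y \<in> exp_semigroup F \<Longrightarrow> Z \<in> F \<Longrightarrow> 0 \<le> t \<Longrightarrow> mexp (t *\<^sub>R Z) ** Y \<in> exp_semigroup F"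

lemma exp_semigroup_mult:
  "X \<in> exp_semigroup F \<Longrightarrow> Y \<in> exp_semigroup F \<Longrightarrow> X ** Y \<in> exp_semigroup F"
  by (induction X rule: exp_semigroup.induct)
    (auto simp: matrix_mul_assoc[symmetric] intro: exp_semigroup.step)

lemma mexp_in_exp_semigroup: "Z \<in> F \<Longrightarrow> 0 \<le> t \<Longrightarrow> mexp (t *\<^sub>R Z) \<in> exp_semigroup F"
  using exp_semigroup.step[OF exp_semigroup.one, of Z F t] by simp

lemma exp_semigroup_subset_SU:
  assumes "F \<subseteq> su" shows "exp_semigroup F \<subseteq> SU"
proof
  fix X assume "X \<in> exp_semigroup F"
  then show "X \<in> SU"
  proof induction
    case (step Y Z t)
    then have "t *\<^sub>R Z \<in> su" using assms subspace_scale[OF subspace_su] by blast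
    then show ?case using step by (intro SU_mult mexp_in_SU)
  qed simp
qed

lemma closed_SU_monoid_closure_exp_semigroup:
  assumes "F \<subseteq> su" shows "closed_SU_monoid (closure (exp_semigroup F))"
proof
  show "closed (closure (exp_semigroup F))" by simp
  show "closure (exp_semigroup F) \<subseteq> SU"
    using exp_semigroup_subset_SU[OF assms] closed_SU by (rule closure_minimal)
  show "mat 1 \<in> closure (exp_semigroup F)" using exp_semigroup.one closure_subset by blast
  fix X Y assume "X \<in> closure (exp_semigroup F)" "Y \<in> closure (exp_semigroup F)"
  then obtain x y where "\<And>n. x n \<in> exp_semigroup F" "x \<longlonglongrightarrow> X" "\<And>n. y n \<in> exp_semigroup F" "y \<longlonglongrightarrow> Y"
    unfolding closure_sequential by blast
  then show "X ** Y \<in> closure (exp_semigroup F)"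
    unfolding closure_sequential
    by (intro exI[of _ "\<lambda>n. x n ** y n"] conjI allI exp_semigroup_mult matmul.tendsto)
qed

lemma linear_conj: "linear (\<lambda>Y. U ** Y ** V)" for U V :: "'n::finite cmat"
  by (rule linearI)
    (simp_all add: matmul.add_left matmul.add_right matmul.scaleR_left matmul.scaleR_right)

lemma dim_range_add_rank_one:
  fixes T :: "'a::euclidean_space \<Rightarrow> 'b::euclidean_space"
  assumes "linear T" "u \<noteq> 0" "T u = 0" "v \<notin> range T"
  shows "Suc (dim (range T)) \<le> dim (range (\<lambda>Y. T Y + (u \<bullet> Y) *\<^sub>R v))" (is "_ \<le> dim (range ?T')")
proof -
  have "T Y = ?T' (Y - ((u \<bullet> Y) / (u \<bullet> u)) *\<^sub>R u)" "v = ?T' (u /\<^sub>R (u \<bullet> u))" for Y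
    using assms(2,3)
    by (simp_all add: linear_diff[OF assms(1)] linear_scale[OF assms(1)] inner_diff_right)
  then have "insert v (range T) \<subseteq> range ?T'"
    by (metis (no_types, lifting) image_subset_iff insert_subset rangeI)
  then have "dim (insert v (range T)) \<le> dim (range ?T')" by (rule dim_subset)
  moreover have "v \<notin> span (range T)"
    using assms(4) linear_subspace_image[OF assms(1) subspace_UNIV]
    by (simp add: span_eq_iff[THEN iffD2])
  ultimately show ?thesis by (simp add: dim_insert)
qed

locale bracket_generating =
  fixes F :: "'n::finite cmat set"
  assumes F_subset_su: "F \<subseteq> su"
    and generates: "lie_algebra L \<Longrightarrow> F \<subseteq> L \<Longrightarrow> su \<subseteq> L"
begin

abbreviation S :: "'n cmat set" where "S \<equiv> exp_semigroup F"

lemma S_subset_SU: "S \<subseteq> SU"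
  using F_subset_su by (rule exp_semigroup_subset_SU)

lemma SU_subset_closure: "SU \<subseteq> closure S"
proof -
  interpret closed_SU_monoid "closure S"
    using F_subset_su by (rule closed_SU_monoid_closure_exp_semigroup)
  have nonneg: "mexp (t *\<^sub>R Z) \<in> closure S" if "Z \<in> F" "t \<ge> 0" for Z t
    using mexp_in_exp_semigroup[OF that] closure_subset by blast
  have "Z \<in> tangent" if Z: "Z \<in> F" for Z
  proof -
    have su: "Z \<in> su" using Z F_subset_su by blast
    have "mexp (t *\<^sub>R Z) \<in> closure S" for t
    proof (cases "t \<ge> 0")
      case False
      have "mexp (t *\<^sub>R Z) = adjoint_mat (mexp ((- t) *\<^sub>R Z))"
        using mexp_minus_su[OF subspace_scale[OF subspace_su su], of "- t"] by simp
      then show ?thesis using adjoint_in[OF nonneg[OF Z, of "- t"]] False by simp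
    qed (use nonneg Z in auto)
    then show ?thesis using su by (simp add: tangent_def)
  qed
  then have "su \<subseteq> tangent" by (intro generates lie_algebra_tangent) auto
  then show ?thesis by (rule SU_subset_if_su_subset_tangent)
qed

abbreviation conjugates :: "'n cmat set" where
  "conjugates \<equiv> {s ** Z ** adjoint_mat s | s Z. s \<in> S \<and> Z \<in> F}"

lemma conj_in_span_conjugates:
  assumes "U \<in> SU" "Y \<in> span conjugates"
  shows "U ** Y ** adjoint_mat U \<in> span conjugates"
proof -
  have S: "u ** Y ** adjoint_mat u \<in> span conjugates" if "u \<in> S" for u
  proof -
    have "(\<lambda>Y. u ** Y ** adjoint_mat u) ` conjugates \<subseteq> conjugates"
    proof clarify
      fix s Z assume "s \<in> S" "Z \<in> F"
      then show "\<exists>s' Z'. u ** (s ** Z ** adjoint_mat s) ** adjoint_mat u = s' ** Z' ** adjoint_mat s'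
          \<and> s' \<in> S \<and> Z' \<in> F"
        using exp_semigroup_mult[OF that]
        by (intro exI[of _ "u ** s"] exI[of _ Z]) (simp add: adjoint_mat_mult matrix_mul_assoc)
    qed
    then show ?thesis
      using linear_span_image[OF linear_conj, of u "adjoint_mat u" conjugates] span_mono assms(2)
      by blast
  qed
  have "U \<in> closure S" using SU_subset_closure assms(1) by blast
  then obtain u where u: "\<And>n. u n \<in> S" "u \<longlonglongrightarrow> U"
    unfolding closure_sequential by blast
  have "(\<lambda>n. u n ** Y ** adjoint_mat (u n)) \<longlonglongrightarrow> U ** Y ** adjoint_mat U"
    by (intro matmul.tendsto bounded_linear.tendsto[OF bounded_linear_adjoint_mat] u tendsto_const)
  then show ?thesis
    by (rule closed_sequentially[OF closed_subspace[OF subspace_span], rotated]) (rule S[OF u(1)])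
qed

lemma su_subset_span_conjugates: "su \<subseteq> span conjugates"
proof (rule generates)
  have "conjugates \<subseteq> su" using F_subset_su S_subset_SU by (auto intro!: su_conj)
  then have span_su: "span conjugates \<subseteq> su" by (intro span_minimal subspace_su)
  show "lie_algebra (span conjugates)"
  proof
    fix X Y assume X: "X \<in> span conjugates" and Y: "Y \<in> span conjugates"
    show "commutator X Y \<in> span conjugates"
    proof (rule commutator_in_subspace[OF subspace_span])
      fix t
      have "t *\<^sub>R X \<in> su" using X span_su subspace_scale[OF subspace_su] by blast
      then show "mexp (t *\<^sub>R X) ** Y ** mexp (t *\<^sub>R (- X)) \<in> span conjugates"
        using conj_in_span_conjugates[OF mexp_in_SU Y, of "t *\<^sub>R X"] mexp_minus_su[of "t *\<^sub>R X"]
        by simp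
    qed
  qed simp
  show "F \<subseteq> span conjugates"
  proof
    fix Z assume "Z \<in> F"
    then have "Z \<in> conjugates"
      using exp_semigroup.one[of F] by (intro CollectI exI[of _ "mat 1"] exI[of _ Z]) simp
    then show "Z \<in> span conjugates" by (rule span_base)
  qed
qed

lemma new_direction:
  assumes W: "subspace W" "\<not> su \<subseteq> W" and r: "r \<in> SU"
  shows "\<exists>s\<in>S. \<exists>Z\<in>F. (r ** s) ** Z ** adjoint_mat (r ** s) \<notin> W"
proof (rule ccontr)
  assume neg: "\<not> ?thesis"
  have "span conjugates \<subseteq> (\<lambda>Y. r ** Y ** adjoint_mat r) -` W"
    using neg by (intro span_minimal linear_subspace_vimage[OF linear_conj W(1)])
      (auto simp: adjoint_mat_mult matrix_mul_assoc)
  then have conj_W: "r ** Y ** adjoint_mat r \<in> W" if "Y \<in> su" for Y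
    using su_subset_span_conjugates that by blast
  have "A \<in> W" if "A \<in> su" for A
  proof -
    have "r ** (adjoint_mat r ** A ** r) ** adjoint_mat r
        = (r ** adjoint_mat r) ** A ** (r ** adjoint_mat r)"
      by (simp only: matrix_mul_assoc)
    then show ?thesis
      using conj_W[OF su_conj[OF SU_adjoint[OF r] that]] by (simp add: SU_adjoint_right[OF r])
  qed
  then show False using W(2) by blast
qed

definition chart :: "('n cmat \<Rightarrow> 'n cmat) \<Rightarrow> ('n cmat \<Rightarrow> 'n cmat) \<Rightarrow> bool" where
  "chart f T \<longleftrightarrow> continuous_on UNIV f \<and> range f \<subseteq> S \<and> linear T \<and> range T \<subseteq> su \<and>
     (f has_derivative (\<lambda>Y. T Y ** f 0)) (at 0)"

text \<open>A direction \<open>u\<close> in the kernel of \<open>T\<close> serves as the parameter of one more exponential factor; its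
  duration is \<open>exp (u \<bullet> Y)\<close> because it has to be positive for every \<open>Y\<close>.\<close>

lemma chart_extend_has_derivative:
  fixes f T :: "'n cmat \<Rightarrow> 'n cmat" and s u Z :: "'n cmat"
  assumes f: "(f has_derivative (\<lambda>Y. T Y ** f 0)) (at 0)" and fs_SU: "f 0 ** s \<in> SU"
  defines "g \<equiv> \<lambda>Y. f Y ** s ** mexp (exp (u \<bullet> Y) *\<^sub>R Z)"
  shows "(g has_derivative
      (\<lambda>Y. (T Y + (u \<bullet> Y) *\<^sub>R ((f 0 ** s) ** Z ** adjoint_mat (f 0 ** s))) ** g 0)) (at 0)"
proof -
  have "((\<lambda>Y. exp (u \<bullet> Y)) has_derivative (\<lambda>Y. u \<bullet> Y)) (at 0)"
    by (auto intro!: derivative_eq_intros)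
  moreover have "((\<lambda>t. mexp (t *\<^sub>R Z)) has_derivative (\<lambda>h. h *\<^sub>R (Z ** mexp Z))) (at (exp (u \<bullet> 0)))"
    using mexp_has_vector_derivative[of Z 1] by (simp add: has_vector_derivative_def)
  ultimately have "((\<lambda>Y. mexp (exp (u \<bullet> Y) *\<^sub>R Z)) has_derivative
      (\<lambda>Y. (u \<bullet> Y) *\<^sub>R (Z ** mexp Z))) (at 0)"
    by (rule has_derivative_compose)
  from matmul.FDERIV[OF bounded_linear.has_derivative[OF matmul.bounded_linear_left f, of s] this]
  have "(g has_derivative
      (\<lambda>Y. f 0 ** s ** ((u \<bullet> Y) *\<^sub>R (Z ** mexp Z)) + T Y ** f 0 ** s ** mexp Z)) (at 0)"
    by (simp add: g_def)
  moreover have "(f 0 ** s) ** Z ** adjoint_mat (f 0 ** s) ** g 0 = f 0 ** s ** (Z ** mexp Z)"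
  proof -
    have "(f 0 ** s) ** Z ** adjoint_mat (f 0 ** s) ** g 0
        = f 0 ** s ** Z ** (adjoint_mat (f 0 ** s) ** (f 0 ** s)) ** mexp Z"
      by (simp only: g_def matrix_mul_assoc inner_zero_right exp_zero scaleR_one)
    then show ?thesis unfolding SU_adjoint_left[OF fs_SU] by (simp add: matrix_mul_assoc)
  qed
  then have "f 0 ** s ** ((u \<bullet> Y) *\<^sub>R (Z ** mexp Z)) + T Y ** f 0 ** s ** mexp Z
      = (T Y + (u \<bullet> Y) *\<^sub>R ((f 0 ** s) ** Z ** adjoint_mat (f 0 ** s))) ** g 0" for Y
    by (simp add: matmul.add_left matmul.scaleR_left matmul.scaleR_right)
      (simp add: g_def matrix_mul_assoc add.commute)
  ultimately show ?thesis by simp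
qed

lemma chart_extend:
  assumes chart: "chart f T" and not_onto: "\<not> su \<subseteq> range T"
  shows "\<exists>g T'. chart g T' \<and> Suc (dim (range T)) \<le> dim (range T')"
proof -
  have cont_f: "continuous_on UNIV f" and f_S: "\<And>Y. f Y \<in> S" and lin_T: "linear T"
    and range_T: "range T \<subseteq> su" and deriv_f: "(f has_derivative (\<lambda>Y. T Y ** f 0)) (at 0)"
    using chart by (auto simp: chart_def)
  obtain s Z where sZ: "s \<in> S" "Z \<in> F"
    and new_dir: "(f 0 ** s) ** Z ** adjoint_mat (f 0 ** s) \<notin> range T"
    using new_direction[OF linear_subspace_image[OF lin_T subspace_UNIV] not_onto] f_S S_subset_SU
    by blast
  have fs_SU: "f 0 ** s \<in> SU" using f_S sZ(1) S_subset_SU SU_mult by blast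
  define v where "v = (f 0 ** s) ** Z ** adjoint_mat (f 0 ** s)"
  have v: "v \<in> su" unfolding v_def using F_subset_su sZ(2) by (intro su_conj fs_SU) auto
  have "\<not> inj T" using linear_inj_imp_surj[OF lin_T] not_onto by auto
  then obtain u where u: "u \<noteq> 0" "T u = 0"
    unfolding linear_injective_0[OF lin_T] by blast
  define g where "g Y = f Y ** s ** mexp (exp (u \<bullet> Y) *\<^sub>R Z)" for Y
  define T' where "T' Y = T Y + (u \<bullet> Y) *\<^sub>R v" for Y
  have "continuous_on UNIV g"
    unfolding g_def
    by (intro matmul.continuous_on cont_f continuous_on_const
        continuous_on_compose2[OF continuous_on_mexp[of UNIV]] continuous_intros) auto
  moreover have "g Y \<in> S" for Y
    unfolding g_def by (intro exp_semigroup_mult f_S sZ mexp_in_exp_semigroup) simp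
  moreover have "linear T'"
    unfolding T'_def
    by (rule linearI)
      (simp_all add: linear_add[OF lin_T] linear_scale[OF lin_T] inner_add_right algebra_simps)
  moreover have "range T' \<subseteq> su"
    using range_T v
    by (auto simp: T'_def intro!: subspace_add[OF subspace_su] subspace_scale[OF subspace_su])
  moreover have "(g has_derivative (\<lambda>Y. T' Y ** g 0)) (at 0)"
    using chart_extend_has_derivative[OF deriv_f fs_SU, of u Z]
    by (simp add: g_def[abs_def] T'_def v_def)
  ultimately have "chart g T'" by (auto simp: chart_def)
  moreover have "Suc (dim (range T)) \<le> dim (range T')"
    unfolding T'_def using dim_range_add_rank_one[OF lin_T u new_dir] by (simp add: v_def)
  ultimately show ?thesis by blast
qed

lemma chart_exists: "\<exists>f T. chart f T \<and> range T = su"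
proof -
  have "\<exists>f T. chart f T \<and> (d \<le> dim (range T) \<or> su \<subseteq> range T)" for d
  proof (induction d)
    case 0
    have "chart (\<lambda>Y. mat 1) (\<lambda>Y. 0)"
      using exp_semigroup.one subspace_0[OF subspace_su]
      by (auto simp: chart_def linear_zero continuous_on_const)
    then show ?case by blast
  next
    case (Suc d)
    then obtain f T where fT: "chart f T" "d \<le> dim (range T) \<or> su \<subseteq> range T" by blast
    show ?case
    proof (cases "su \<subseteq> range T")
      case True
      then show ?thesis using fT by blast
    next
      case False
      then show ?thesis using chart_extend[OF fT(1) False] fT(2) by (meson Suc_le_mono le_trans)
    qed
  qed
  from this[of "Suc (dim (su :: 'n cmat set))"]
  obtain f T where fT: "chart f T" "Suc (dim (su :: 'n cmat set)) \<le> dim (range T) \<or> su \<subseteq> range T"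
    by blast
  then have sub: "range T \<subseteq> su" by (simp add: chart_def)
  then have "dim (range T) \<le> dim (su :: 'n cmat set)" by (rule dim_subset)
  then have "range T = su" using sub fT(2) by auto
  then show ?thesis using fT(1) by blast
qed

lemma S_contains_SU_ball: "\<exists>h\<in>S. \<exists>\<epsilon>>0. SU \<inter> ball h \<epsilon> \<subseteq> S"
proof -
  obtain f T where chart: "chart f T" and range_T: "range T = su" using chart_exists by blast
  have cont_f: "continuous_on UNIV f" and f_S: "range f \<subseteq> S" and lin_T: "linear T"
    and deriv_f: "(f has_derivative (\<lambda>Y. T Y ** f 0)) (at 0)"
    using chart by (auto simp: chart_def)
  obtain G where G: "linear G" "\<And>A. A \<in> su \<Longrightarrow> T (G A) = A"
    using linear_exists_right_inverse_on[OF lin_T subspace_UNIV] range_T by auto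
  define h where "h Y = f (G (su_part Y))" for Y
  have G_su_part: "bounded_linear (\<lambda>Y. G (su_part Y))"
    using G(1) by (intro bounded_linear_compose[OF _ bounded_linear_su_part])
      (simp add: linear_conv_bounded_linear)
  have G_su_part_0: "G (su_part 0) = 0" using linear_0[OF bounded_linear.linear[OF G_su_part]] .
  have "continuous_on UNIV h"
    unfolding h_def
    by (rule continuous_on_compose2[OF cont_f linear_continuous_on[OF G_su_part]]) simp
  moreover have "(h has_derivative (\<lambda>Y. T (G (su_part Y)) ** f 0)) (at 0)"
    unfolding h_def
    by (rule has_derivative_compose[OF bounded_linear_imp_has_derivative[OF G_su_part]])
      (simp add: G_su_part_0 deriv_f)
  then have "(h has_derivative (\<lambda>Y. su_part Y ** h 0)) (at 0)"
    by (simp add: G(2) su_part_in_su h_def G_su_part_0)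
  moreover have h_S: "range h \<subseteq> S" using f_S by (auto simp: h_def)
  ultimately show ?thesis
    using SU_ball_subset_range[of h] S_subset_SU by (meson order_trans range_subsetD)
qed

theorem SU_subset_exp_semigroup: "SU \<subseteq> S"
proof
  fix U :: "'n cmat"
  assume U: "U \<in> SU"
  obtain h \<epsilon> where h: "h \<in> S" "\<epsilon> > 0" "SU \<inter> ball h \<epsilon> \<subseteq> S"
    using S_contains_SU_ball by blast
  have hSU: "h \<in> SU" using h(1) S_subset_SU by blast
  have "U ** adjoint_mat h \<in> closure S"
    using SU_subset_closure U hSU SU_mult SU_adjoint by blast
  then obtain s where s: "s \<in> S" "dist s (U ** adjoint_mat h) < \<epsilon>"
    using h(2) unfolding closure_approachable by blast
  have sSU: "s \<in> SU" using s(1) S_subset_SU by blast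
  have "s ** (h - adjoint_mat s ** U) ** adjoint_mat h = s - U ** adjoint_mat h"
    by (simp add: matmul.diff_left matmul.diff_right matrix_mul_assoc SU_adjoint_right[OF sSU])
      (simp add: matrix_mul_assoc[symmetric] SU_adjoint_right[OF hSU])
  then have "dist h (adjoint_mat s ** U) = dist s (U ** adjoint_mat h)"
    unfolding dist_norm
    using norm_SU_mult_right[OF SU_adjoint[OF hSU]] norm_SU_mult_left[OF sSU] by metis
  then have "adjoint_mat s ** U \<in> ball h \<epsilon>" using s(2) by simp
  then have "adjoint_mat s ** U \<in> S" using h(3) U sSU SU_mult SU_adjoint by blast
  then have "s ** (adjoint_mat s ** U) \<in> S" by (rule exp_semigroup_mult[OF s(1)])
  then show "U \<in> S" by (simp add: matrix_mul_assoc SU_adjoint_right[OF sSU])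
qed

end

section \<open>Reachability by piecewise constant controls\<close>

lemma at_within_Diff_finite:
  fixes d :: "'a::t1_space"
  assumes "finite D" "d \<notin> D"
  shows "at d within (S - D) = at d within S"
proof (rule at_within_nhd)
  show "open (- D)" using finite_imp_closed[OF assms(1)] by (rule open_Compl)
qed (use assms(2) in auto)

lemma piecewise_continuous_on_left_limit:
  assumes "piecewise_continuous_on a b u" "a < d" "d \<le> b"
  shows "\<exists>l. (u \<longlongrightarrow> l) (at_left d)"
proof -
  obtain D where D: "finite D" "continuous_on ({a..b} - D) u"
    "\<And>d. d \<in> D \<Longrightarrow> a < d \<Longrightarrow> \<exists>l. (u \<longlongrightarrow> l) (at_left d)"
    using assms(1) unfolding piecewise_continuous_on_def by blast
  show ?thesis
  proof (cases "d \<in> D")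
    case False
    then have "(u \<longlongrightarrow> u d) (at d within {a..b})"
      using D(1,2) assms(2,3) by (simp add: continuous_on_def at_within_Diff_finite)
    then have "(u \<longlongrightarrow> u d) (at d within {a..d})"
      by (rule tendsto_within_subset) (use assms(2,3) in auto)
    then show ?thesis unfolding at_within_Icc_at_left[OF assms(2)] by blast
  qed (use D(3) assms(2) in blast)
qed

lemma piecewise_continuous_on_right_limit:
  assumes "piecewise_continuous_on a b u" "a \<le> d" "d < b"
  shows "\<exists>l. (u \<longlongrightarrow> l) (at_right d)"
proof -
  obtain D where D: "finite D" "continuous_on ({a..b} - D) u"
    "\<And>d. d \<in> D \<Longrightarrow> d < b \<Longrightarrow> \<exists>l. (u \<longlongrightarrow> l) (at_right d)"
    using assms(1) unfolding piecewise_continuous_on_def by blast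
  show ?thesis
  proof (cases "d \<in> D")
    case False
    then have "(u \<longlongrightarrow> u d) (at d within {a..b})"
      using D(1,2) assms(2,3) by (simp add: continuous_on_def at_within_Diff_finite)
    then have "(u \<longlongrightarrow> u d) (at d within {d..b})"
      by (rule tendsto_within_subset) (use assms(2,3) in auto)
    then show ?thesis unfolding at_within_Icc_at_right[OF assms(3)] by blast
  qed (use D(3) assms(3) in blast)
qed

lemma piecewise_continuous_on_const: "piecewise_continuous_on a b (\<lambda>t. c)"
  unfolding piecewise_continuous_on_def by (auto intro!: exI[of _ "{}"])

lemma continuous_on_concat_Diff:
  fixes u v :: "real \<Rightarrow> 'a::topological_space"
  assumes "continuous_on ({a..m} - D1) u" "continuous_on ({m..b} - D2) v" "a \<le> m" "m \<le> b"
  shows "continuous_on ({a..b} - insert m (D1 \<union> D2)) (\<lambda>t. if t \<le> m then u t else v t)"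
    (is "continuous_on ({a..b} - ?D) ?w")
proof -
  have "continuous_on (({a..<m} - ?D) \<union> ({m<..b} - ?D)) ?w"
  proof (rule continuous_on_Un_local_open)
    show "continuous_on ({a..<m} - ?D) ?w"
      by (rule continuous_on_eq[OF continuous_on_subset[OF assms(1)]]) auto
    show "continuous_on ({m<..b} - ?D) ?w"
      by (rule continuous_on_eq[OF continuous_on_subset[OF assms(2)]]) auto
    show "openin (top_of_set (({a..<m} - ?D) \<union> ({m<..b} - ?D))) ({a..<m} - ?D)"
      unfolding openin_open by (intro exI[of _ "{..<m}"]) auto
    show "openin (top_of_set (({a..<m} - ?D) \<union> ({m<..b} - ?D))) ({m<..b} - ?D)"
      unfolding openin_open by (intro exI[of _ "{m<..}"]) auto
  qed
  moreover have "({a..<m} - ?D) \<union> ({m<..b} - ?D) = {a..b} - ?D" using assms(3,4) by auto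
  ultimately show ?thesis by (simp only:)
qed

lemma concat_has_left_limit:
  assumes u: "piecewise_continuous_on a m u" and v: "piecewise_continuous_on m b v"
    and d: "a < d" "d \<le> b"
  shows "\<exists>l. ((\<lambda>t. if t \<le> m then u t else v t) \<longlongrightarrow> l) (at_left d)" (is "\<exists>l. (?w \<longlongrightarrow> l) _")
proof (cases "d \<le> m")
  case True
  have "\<forall>\<^sub>F t in at_left d. ?w t = u t"
    by (rule eventually_mono[OF eventually_at_left_real[OF d(1)]]) (use True in auto)
  then show ?thesis
    using piecewise_continuous_on_left_limit[OF u d(1) True] by (simp only: tendsto_cong)
next
  case False
  then have "m < d" by simp
  have "\<forall>\<^sub>F t in at_left d. ?w t = v t"
    by (rule eventually_mono[OF eventually_at_left_real[OF \<open>m < d\<close>]]) auto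
  then show ?thesis
    using piecewise_continuous_on_left_limit[OF v \<open>m < d\<close> d(2)] by (simp only: tendsto_cong)
qed

lemma concat_has_right_limit:
  assumes u: "piecewise_continuous_on a m u" and v: "piecewise_continuous_on m b v"
    and d: "a \<le> d" "d < b"
  shows "\<exists>l. ((\<lambda>t. if t \<le> m then u t else v t) \<longlongrightarrow> l) (at_right d)" (is "\<exists>l. (?w \<longlongrightarrow> l) _")
proof (cases "d < m")
  case True
  have "\<forall>\<^sub>F t in at_right d. ?w t = u t"
    by (rule eventually_mono[OF eventually_at_right_real[OF True]]) auto
  then show ?thesis
    using piecewise_continuous_on_right_limit[OF u d(1) True] by (simp only: tendsto_cong)
next
  case False
  then have "m \<le> d" by simp
  have "\<forall>\<^sub>F t in at_right d. ?w t = v t"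
    by (rule eventually_mono[OF eventually_at_right_real[OF d(2)]]) (use False in auto)
  then show ?thesis
    using piecewise_continuous_on_right_limit[OF v \<open>m \<le> d\<close> d(2)] by (simp only: tendsto_cong)
qed

lemma piecewise_continuous_on_concat:
  assumes u: "piecewise_continuous_on a m u" and v: "piecewise_continuous_on m b v"
    and ab: "a \<le> m" "m \<le> b"
  shows "piecewise_continuous_on a b (\<lambda>t. if t \<le> m then u t else v t)"
proof -
  obtain D1 where D1: "finite D1" "D1 \<subseteq> {a..m}" "continuous_on ({a..m} - D1) u"
    using u unfolding piecewise_continuous_on_def by blast
  obtain D2 where D2: "finite D2" "D2 \<subseteq> {m..b}" "continuous_on ({m..b} - D2) v"
    using v unfolding piecewise_continuous_on_def by blast
  have "finite (insert m (D1 \<union> D2))" "insert m (D1 \<union> D2) \<subseteq> {a..b}"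
    using D1(1,2) D2(1,2) ab by auto
  then show ?thesis
    unfolding piecewise_continuous_on_def
    using continuous_on_concat_Diff[OF D1(3) D2(3) ab]
      concat_has_left_limit[OF u v] concat_has_right_limit[OF u v]
    by (intro exI[of _ "insert m (D1 \<union> D2)"] conjI ballI impI)
      (simp_all only: subset_iff atLeastAtMost_iff)
qed

definition velocities :: "'n::finite cmat \<Rightarrow> 'n cmat list \<Rightarrow> 'n cmat set" where
  "velocities B0 Bs = {B0 + (\<Sum>i<length Bs. c i *\<^sub>R Bs ! i) | c :: nat \<Rightarrow> real. True}"

lemma velocities_subset_iff:
  assumes L: "subspace L"
  shows "velocities B0 Bs \<subseteq> L \<longleftrightarrow> B0 \<in> L \<and> set Bs \<subseteq> L"
proof
  assume vel: "velocities B0 Bs \<subseteq> L"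
  have in_L: "B0 + (\<Sum>i<length Bs. c i *\<^sub>R Bs ! i) \<in> L" for c
    using vel unfolding velocities_def by blast
  have B0: "B0 \<in> L" using in_L[of "\<lambda>_. 0"] by simp
  have "Bs ! j \<in> L" if "j < length Bs" for j
  proof -
    have "(\<Sum>i<length Bs. (if i = j then 1 else 0) *\<^sub>R Bs ! i)
        = (\<Sum>i<length Bs. if i = j then Bs ! j else 0)"
      by (rule sum.cong) auto
    also have "\<dots> = Bs ! j" using that by simp
    finally have "B0 + Bs ! j \<in> L" using in_L[of "\<lambda>i. if i = j then 1 else 0"] by simp
    from subspace_diff[OF L this B0] show ?thesis by simp
  qed
  then show "B0 \<in> L \<and> set Bs \<subseteq> L" using B0 by (auto simp: in_set_conv_nth)
next
  assume "B0 \<in> L \<and> set Bs \<subseteq> L"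
  then show "velocities B0 Bs \<subseteq> L"
    unfolding velocities_def
    by (auto intro!: subspace_add[OF L] subspace_sum[OF L] subspace_scale[OF L])
qed

lemma mexp_shift_has_vector_derivative:
  fixes Y Z :: "'n::finite cmat"
  shows
  "((\<lambda>t. mexp ((t - T) *\<^sub>R Z) ** Y) has_vector_derivative Z ** (mexp ((t - T) *\<^sub>R Z) ** Y)) (at t)"
proof -
  have "((\<lambda>t. t - T) has_vector_derivative 1) (at t)"
    unfolding has_real_derivative_iff_has_vector_derivative[symmetric]
    by (auto intro!: derivative_eq_intros)
  from vector_diff_chain_at[OF this mexp_has_vector_derivative[of Z]]
  have "((\<lambda>t. mexp ((t - T) *\<^sub>R Z)) has_vector_derivative Z ** mexp ((t - T) *\<^sub>R Z)) (at t)"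
    by (simp add: o_def)
  from bounded_linear.has_vector_derivative[OF matmul.bounded_linear_left this]
  show ?thesis by (simp add: matrix_mul_assoc)
qed

lemma has_vector_derivative_concat_left:
  assumes "(f has_vector_derivative D) (at t within {a..m})" "a \<le> t" "t < m" "m \<le> b"
  shows "((\<lambda>t. if t \<le> m then f t else g t) has_vector_derivative D) (at t within {a..b})"
proof -
  have "at t within {a..m} = at t within {a..b}"
    by (rule at_within_nhd[of t "{..<m}"]) (use assms in auto)
  then have "(f has_vector_derivative D) (at t within {a..b})" using assms(1) by simp
  then show ?thesis
    by (rule has_vector_derivative_transform_within[of _ _ _ _ "m - t"])
      (use assms in \<open>auto simp: dist_real_def\<close>)
qed

lemma has_vector_derivative_concat_right:
  assumes "(g has_vector_derivative D) (at t within S)" "t \<in> S" "m < t"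
  shows "((\<lambda>t. if t \<le> m then f t else g t) has_vector_derivative D) (at t within S)"
  using assms(1)
  by (rule has_vector_derivative_transform_within[of _ _ _ _ "t - m"])
    (use assms in \<open>auto simp: dist_real_def\<close>)

lemma is_solution_append_mexp:
  assumes sol: "is_solution B0 Bs u T X" and "0 \<le> T" "0 \<le> \<tau>"
    and Z: "Z = B0 + (\<Sum>i<length Bs. c i *\<^sub>R Bs ! i)"
  shows "is_solution B0 Bs (\<lambda>i t. if t \<le> T then u i t else c i) (T + \<tau>)
    (\<lambda>t. if t \<le> T then X t else mexp ((t - T) *\<^sub>R Z) ** X T)" (is "is_solution _ _ ?v _ ?W")
proof -
  obtain S where S: "finite S" "\<And>t. t \<in> {0..T} - S \<Longrightarrow>
      (X has_vector_derivative ((B0 + (\<Sum>i<length Bs. u i t *\<^sub>R Bs ! i)) ** X t)) (at t within {0..T})"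
    and X: "X 0 = mat 1" "continuous_on {0..T} X"
    using sol unfolding is_solution_def by blast
  have "continuous_on ({0..T} \<union> {T..T + \<tau>}) ?W"
  proof (rule continuous_on_If)
    show "continuous_on {T..T + \<tau>} (\<lambda>t. mexp ((t - T) *\<^sub>R Z) ** X T)"
      by (rule continuous_on_vector_derivative)
        (rule has_vector_derivative_at_within[OF mexp_shift_has_vector_derivative])
  qed (use X in auto)
  moreover have "{0..T} \<union> {T..T + \<tau>} = {0..T + \<tau>}"
    using assms(2,3) by auto
  moreover have "(?W has_vector_derivative ((B0 + (\<Sum>i<length Bs. ?v i t *\<^sub>R Bs ! i)) ** ?W t))
      (at t within {0..T + \<tau>})"
    if t: "t \<in> {0..T + \<tau>} - insert T S" for t
  proof (cases "t < T")
    case True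
    then show ?thesis
      using has_vector_derivative_concat_left[OF S(2)[of t] _ True, of "T + \<tau>"] t assms(3) by simp
  next
    case False
    then show ?thesis
      using has_vector_derivative_concat_right[OF has_vector_derivative_at_within[OF
            mexp_shift_has_vector_derivative[of T Z "X T" t]], of "{0..T + \<tau>}" T X] t
      by (simp add: Z)
  qed
  ultimately show ?thesis
    unfolding is_solution_def using S(1) X(1) assms(2)
    by (intro conjI exI[of _ "insert T S"]) auto
qed

lemma reachable_at_mexp_mult:
  assumes "reachable_at B0 Bs T Y" "Z \<in> velocities B0 Bs" "0 \<le> T" "0 \<le> \<tau>"
  shows "reachable_at B0 Bs (T + \<tau>) (mexp (\<tau> *\<^sub>R Z) ** Y)"
proof -
  obtain u X where u: "\<forall>i<length Bs. piecewise_continuous_on 0 T (u i)"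
    and X: "is_solution B0 Bs u T X" and Y: "X T = Y"
    using assms(1) unfolding reachable_at_def by blast
  obtain c where "Z = B0 + (\<Sum>i<length Bs. c i *\<^sub>R Bs ! i)"
    using assms(2) unfolding velocities_def by blast
  from is_solution_append_mexp[OF X assms(3,4) this]
  have "is_solution B0 Bs (\<lambda>i t. if t \<le> T then u i t else c i) (T + \<tau>)
    (\<lambda>t. if t \<le> T then X t else mexp ((t - T) *\<^sub>R Z) ** X T)" (is "is_solution _ _ ?v _ ?W") .
  moreover have "?W (T + \<tau>) = mexp (\<tau> *\<^sub>R Z) ** Y"
    using assms(4) by (cases "\<tau> = 0") (simp_all flip: Y)
  moreover have "piecewise_continuous_on 0 (T + \<tau>) (?v i)" if "i < length Bs" for i
    using u that assms(3,4)
    by (intro piecewise_continuous_on_concat piecewise_continuous_on_const) auto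
  ultimately show ?thesis
    unfolding reachable_at_def by (intro exI[of _ ?v] exI[of _ ?W] conjI allI impI)
qed

lemma exp_semigroup_reachable:
  assumes "Y \<in> exp_semigroup (velocities B0 Bs)"
  shows "\<exists>T\<ge>0. reachable_at B0 Bs T Y"
  using assms
proof induction
  case one
  have "is_solution B0 Bs (\<lambda>i t. 0) 0 (\<lambda>t. mat 1)"
    by (auto simp: is_solution_def intro!: exI[of _ "{0}"])
  then have "reachable_at B0 Bs 0 (mat 1)"
    unfolding reachable_at_def using piecewise_continuous_on_const
    by (intro exI[of _ "\<lambda>i t. 0"] exI[of _ "\<lambda>t. mat 1"]) simp
  then show ?case by blast
next
  case (step Y Z t)
  then show ?case using reachable_at_mexp_mult by (meson add_nonneg_nonneg)
qed

section \<open>Structural controllability\<close>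

theorem controllable_if_bracket_generating:
  assumes "B0 \<in> su" "set Bs \<subseteq> su"
    and "\<And>L. lie_algebra L \<Longrightarrow> B0 \<in> L \<Longrightarrow> set Bs \<subseteq> L \<Longrightarrow> su \<subseteq> L"
  shows "controllable B0 Bs"
proof -
  interpret bracket_generating "velocities B0 Bs"
  proof
    show "velocities B0 Bs \<subseteq> su"
      using assms(1,2) by (simp add: velocities_subset_iff[OF subspace_su])
    show "su \<subseteq> L" if "lie_algebra L" "velocities B0 Bs \<subseteq> L" for L
      using assms(3)[OF that(1)] that(2) velocities_subset_iff[OF lie_algebra.subspace[OF that(1)]]
      by blast
  qed
  show ?thesis
    unfolding controllable_def using SU_subset_exp_semigroup exp_semigroup_reachable by blast
qed

lemma zero_in_Sigma_f: "0 \<in> Sigma_f G"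
  unfolding Sigma_f_def by (intro CollectI exI[of _ "\<lambda>_. 0"]) simp

lemma in_Sigma_f:
  assumes "finite G" "g \<in> G" shows "g \<in> Sigma_f G"
proof -
  have "(\<Sum>h\<in>G. (if h = g then 1 else 0) *\<^sub>R h) = (\<Sum>h\<in>G. if h = g then g else 0)"
    by (rule sum.cong) auto
  also have "\<dots> = g" using assms by simp
  finally show ?thesis
    unfolding Sigma_f_def by (intro CollectI exI[of _ "\<lambda>h. if h = g then 1 else 0"]) simp
qed

lemma structurally_controllable_if_bracket_generating:
  assumes "B0 \<in> Sigma_r As" "As \<subseteq> su" "finite G" "G \<subseteq> su"
    and generates: "\<And>L. lie_algebra L \<Longrightarrow> B0 \<in> L \<Longrightarrow> G \<subseteq> L \<Longrightarrow> su \<subseteq> L"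
  shows "structurally_controllable As G"
proof -
  obtain xs where "set xs = G" using finite_list[OF assms(3)] by blast
  then have Bs: "set (0 # xs) = insert 0 G" by simp
  have "controllable B0 (0 # xs)"
  proof (rule controllable_if_bracket_generating)
    show "B0 \<in> su" using assms(1) Sigma_r_subset_su[OF assms(2)] by blast
    show "set (0 # xs) \<subseteq> su" using assms(4) subspace_0[OF subspace_su] unfolding Bs by blast
  qed (use generates Bs in blast)
  moreover have "set (0 # xs) \<subseteq> Sigma_f G"
    unfolding Bs using in_Sigma_f[OF assms(3)] zero_in_Sigma_f by blast
  ultimately show ?thesis
    unfolding structurally_controllable_def using assms(1)
    by (intro exI[of _ B0] exI[of _ "0 # xs"]) simp
qed

lemma finite_matrix_unit_combinations:
  fixes S1 S2 S3 :: "'n::{finite,linorder} cmat set"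
  assumes "S1 \<subseteq> {Bmat i j | i j. i < j}" "S2 \<subseteq> {Cmat i j | i j. i < j}" "S3 \<subseteq> {Dmat i j | i j. i < j}"
  shows "finite (S1 \<union> S2 \<union> S3)"
proof -
  have "finite {M i j | i j. i < j}" for M :: "'n \<Rightarrow> 'n \<Rightarrow> 'n cmat"
    by (rule finite_subset[of _ "range (\<lambda>(i, j). M i j)"]) auto
  then show ?thesis using assms by (simp add: finite_subset)
qed

lemma matrix_unit_combinations_subset_su:
  fixes S1 S2 S3 :: "'n::{finite,linorder} cmat set"
  assumes "S1 \<subseteq> {Bmat i j | i j. i < j}" "S2 \<subseteq> {Cmat i j | i j. i < j}" "S3 \<subseteq> {Dmat i j | i j. i < j}"
  shows "S1 \<union> S2 \<union> S3 \<subseteq> su"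
proof -
  have "Bmat i j \<in> su" "Cmat i j \<in> su" if "i < j" for i j :: 'n
    using that skew_unit_in_su[of i j] by (auto simp: Bmat_eq_skew_unit Cmat_eq_skew_unit)
  then show ?thesis using assms Dmat_in_su by blast
qed

theorem theorem5:
  fixes As S1 S2 S3 :: "('n::{finite,linorder}) cmat set"
  assumes n2: "CARD('n) \<ge> 2"
    and As_fin: "finite As" and As_su: "As \<subseteq> su"
    and S1: "S1 \<subseteq> {Bmat i j | i j. i < j}"
    and S2: "S2 \<subseteq> {Cmat i j | i j. i < j}"
    and S3: "S3 \<subseteq> {Dmat i j | i j. i < j}"
    and not_conn: "\<not> graph_connected (contr_edges S1 S2 S3)"
    and i: "\<forall>K\<in>components (contr_edges S1 S2 S3). card K \<ge> 3"
    and ii: "\<not> has_multi_edge (drift_edges As)"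
       "graph_connected (drift_edges As \<union> contr_edges S1 S2 S3)"
    and iii: "has_self_loop (drift_edges As \<union> contr_edges S1 S2 S3) \<or>
       (\<exists>w. is_cycle (drift_edges As \<union> contr_edges S1 S2 S3) w \<and> odd (num_red w))"
  shows "structurally_controllable As (S1 \<union> S2 \<union> S3)"
proof -
  obtain B0 where B0: "B0 \<in> Sigma_r As" and drift: "drift_edges {B0} = drift_edges As"
    using generic_drift_exists[OF As_fin As_su] by blast
  show ?thesis
  proof (rule structurally_controllable_if_bracket_generating[OF B0 As_su])
    show "finite (S1 \<union> S2 \<union> S3)" "S1 \<union> S2 \<union> S3 \<subseteq> su"
      using S1 S2 S3
      by (rule finite_matrix_unit_combinations, rule matrix_unit_combinations_subset_su)
    fix L :: "'n cmat set"
    assume L: "lie_algebra L" "B0 \<in> L" "S1 \<union> S2 \<union> S3 \<subseteq> L"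
    interpret control_graph L "contr_edges S1 S2 S3"
      using L(1,3) by (rule control_graph_contr_edges)
    have "B0 \<in> su" using B0 Sigma_r_subset_su[OF As_su] by blast
    from su_subset_if_loop_or_odd_cycle[OF L(2) this _ i] show "su \<subseteq> L"
      using ii iii by (simp add: drift)
  qed
qed

end
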